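(* Let $p \in (0,1)$ with $p \leq 3/4$, let $q \in [0,1]$, and let $(X_n)_{n \geq 1}$ be the elephant random walk with memory parameter $p$ and first-step parameter $q$. (a) If $p < 3/4$, then $$\limsup_{n \to \infty} \frac{|X_n|}{\sqrt{n \log\log n}} = \sqrt{\frac{2}{3-4p}} \quad \text{almost surely.}$$ (b) If $p = 3/4$, then $$\limsup_{n \to \infty} \frac{|X_n|}{\sqrt{n \log n \,\log\log\log n}} = \sqrt{2} \quad \text{almost surely.}$$
   Context: Elephant random walk (ERW) with memory parameter $p \in (0,1)$ and first-step parameter $q \in [0,1]$: the process on $\mathbb{Z}$ with $X_0 = 0$ and $X_{n+1} = X_n + \eta_{n+1}$, i.e. $X_n = \sum_{k=1}^n \eta_k$, where the steps $\eta_k \in \{-1,+1\}$ are generated as follows. The first step satisfies $\mathbb{P}(\eta_1 = 1) = q$ and $\mathbb{P}(\eta_1 = -1) = 1-q$. For $n \geq 1$, at time $n+1$ an index $n'$ is chosen uniformly at random from $\{1,\dots,n\}$ (each with probability $1/n$), and then $\eta_{n+1} = \eta_{n'}$ with probability $p$ and $\eta_{n+1} = -\eta_{n'}$ with probability $1-p$. Equivalently, for $n \geq 1$ and $\eta \in \{-1,+1\}$, $$\mathbb{P}[\eta_{n+1} = \eta \mid \eta_1,\dots,\eta_n] = \frac{1}{2n}\sum_{k=1}^n \left[1 + (2p-1)\eta_k \eta\right].$$ The normalizing sequences are considered for $n$ large enough that the iterated logarithms are defined and positive. *)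

theory Defs
  imports "HOL-Probability.Probability"
begin

text \<open>
  Law of the next step of an elephant random walk given the past steps \<open>e 1, \<dots>, e n\<close>:
  a uniformly chosen past step is repeated with probability \<open>p\<close> and reversed with
  probability \<open>1 - p\<close>. Only meaningful for \<open>n \<ge> 1\<close> and \<open>0 \<le> p \<le> 1\<close>.
\<close>

definition erw_next_step :: "real \<Rightarrow> nat \<Rightarrow> (nat \<Rightarrow> int) \<Rightarrow> int pmf" where
  "erw_next_step p n e = do {
     k \<leftarrow> pmf_of_set {1..n};
     b \<leftarrow> bernoulli_pmf p;
     return_pmf (if b then e k else - e k)
   }"

lemma pmf_erw_next_step:
  assumes "n \<ge> 1" and "0 \<le> p" "p \<le> 1"
    and "\<And>k. k \<in> {1..n} \<Longrightarrow> e k \<in> {-1, 1}" and "s \<in> {-1, 1}"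
  shows "pmf (erw_next_step p n e) s =
    1 / (2 * real n) * (\<Sum>k=1..n. 1 + (2 * p - 1) * real_of_int (e k) * real_of_int s)"
proof -
  have *: "pmf (bernoulli_pmf p \<bind> (\<lambda>b. return_pmf (if b then e k else - e k))) s =
      (1 + (2 * p - 1) * real_of_int (e k) * real_of_int s) / 2" if "k \<in> {1..n}" for k
    using assms(2,3,5) assms(4)[OF that]
    by (auto simp: pmf_bind field_simps)
  have "pmf (erw_next_step p n e) s =
      (\<Sum>k=1..n. pmf (bernoulli_pmf p \<bind> (\<lambda>b. return_pmf (if b then e k else - e k))) s) / real n"
    unfolding erw_next_step_def using assms(1)
    by (subst pmf_bind_pmf_of_set) auto
  also have "\<dots> = (\<Sum>k=1..n. (1 + (2 * p - 1) * real_of_int (e k) * real_of_int s) / 2) / real n"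
    by (intro arg_cong2[where f="(/)"] sum.cong refl *) auto
  finally show ?thesis
    by (simp add: sum_divide_distrib[symmetric])
qed

text \<open>
  The \<open>\<sigma>\<close>-algebra generated by the steps \<open>\<eta> 1, \<dots>, \<eta> n\<close>.
\<close>

definition erw_history :: "'a measure \<Rightarrow> (nat \<Rightarrow> 'a \<Rightarrow> int) \<Rightarrow> nat \<Rightarrow> 'a measure" where
  "erw_history M \<eta> n = sigma (space M) {\<eta> k -` A \<inter> space M | k A. k \<in> {1..n}}"

text \<open>
  Steps are indexed from 1; \<open>\<eta> 0\<close> is unconstrained and never used.
  \<open>real_cond_exp\<close> applied to an indicator is the conditional probability.
\<close>

locale elephant_random_walk = prob_space M
  for M :: "'a measure" and p q :: real and \<eta> :: "nat \<Rightarrow> 'a \<Rightarrow> int" +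
  assumes step_measurable: "\<And>k. k \<ge> 1 \<Longrightarrow> \<eta> k \<in> measurable M (count_space UNIV)"
    and step_values: "\<And>k \<omega>. k \<ge> 1 \<Longrightarrow> \<omega> \<in> space M \<Longrightarrow> \<eta> k \<omega> \<in> {-1, 1}"
    and first_step_pos: "prob {\<omega> \<in> space M. \<eta> 1 \<omega> = 1} = q"
    and first_step_neg: "prob {\<omega> \<in> space M. \<eta> 1 \<omega> = -1} = 1 - q"
    and next_step: "\<And>n s. n \<ge> 1 \<Longrightarrow> s \<in> {-1, 1} \<Longrightarrow>
      AE \<omega> in M.
        real_cond_exp M (erw_history M \<eta> n) (indicator {\<omega> \<in> space M. \<eta> (n + 1) \<omega> = s}) \<omega> =
        pmf (erw_next_step p n (\<lambda>k. \<eta> k \<omega>)) s"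

definition erw_position :: "(nat \<Rightarrow> 'a \<Rightarrow> int) \<Rightarrow> nat \<Rightarrow> 'a \<Rightarrow> int" where
  "erw_position \<eta> n \<omega> = (\<Sum>k=1..n. \<eta> k \<omega>)"

lemma (in elephant_random_walk) erw_history_subalgebra: "subalgebra M (erw_history M \<eta> n)"
proof -
  have "{\<eta> k -` A \<inter> space M | k A. k \<in> {1..n}} \<subseteq> sets M"
    using measurable_sets[OF step_measurable] by auto
  then show ?thesis
    unfolding subalgebra_def erw_history_def
    by (auto simp: space_measure_of_conv sets_measure_of_conv intro: sets.sigma_sets_subset[THEN subsetD])
qed

end

theory Submission
  imports Defs "HOL-Real_Asymp.Real_Asymp"
begin

text \<open>
  With \<open>s = 2 * p - 1\<close>, the walk multiplied by \<open>A n = (\<Prod>k<n. k / (k + s))\<close> is a martingale whose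
  increments are two-valued with conditional variance \<open>(A n)\<^sup>2 * (1 - m\<^sup>2)\<close>, where \<open>m\<close> is the drift,
  i.e. \<open>s\<close> times the empirical mean of the past steps. Let \<open>V n\<close> be the sum of the \<open>(A k)\<^sup>2\<close>. Hoeffding's
  lemma makes the martingale subgaussian with variance proxy \<open>V n\<close>, and a maximal inequality along
  a geometric scale gives the upper half of the law of the iterated logarithm; in particular the
  drift tends to \<open>0\<close>. Hence the conditional moment generating functions are asymptotically Gaussian
  from below as well, an exponential tilt yields matching lower bounds for the tails of block sums
  conditionally on the past, and a conditional Borel-Cantelli argument gives the lower half. The
  constants come from \<open>A n ~ Gamma (1 + s) * n powr (- s)\<close> and the resulting growth of \<open>V n\<close>, which
  is a power of \<open>n\<close> for \<open>p < 3 / 4\<close> and \<open>ln n\<close> for \<open>p = 3 / 4\<close>, up to constants.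
\<close>

subsection \<open>Analytic tools\<close>

text \<open>The obstacle lies in the lower half. The conditional variance depends on the drift,
  which is small only almost surely and only from a random time on. The upper half does not feel
  this, since Hoeffding's variance proxy is free of the drift. For the lower half, steps with large
  drift are taken out of the block sums by a rule that looks only at the past, and a compensating
  variance term is put in their place. The exponential estimates then hold on every event
  \<open>G\<close> of the past, which is the form that the Borel-Cantelli argument consumes, and the
  compensator is zero on late blocks once the drift tends to \<open>0\<close>. The tilt has order
  \<open>sqrt (ln (ln V) / V)\<close>, so a second-order expansion of the moment generating function
  needs \<open>(A n)^2 * ln (ln (V n)) / V n\<close> to tend to \<open>0\<close> (Kolmogorov's
  condition). The threshold for \<open>p\<close> is the one for divergence of \<open>V\<close>: the
  squares \<open>(A n)^2\<close> behave like \<open>n powr (- 2 * s)\<close>, and their sum diverges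
  exactly for \<open>s\<close> at most \<open>1 / 2\<close>. The scale ratio is near
  \<open>1\<close> in the upper half, so that little is lost inside a block, and large in the lower
  half, so that the past of a block is negligible.\<close>

lemma stolz_cesaro:
  fixes a b :: "nat \<Rightarrow> real"
  assumes "eventually (\<lambda>n. b n < b (Suc n)) sequentially"
    and lim_b: "filterlim b at_top sequentially"
    and lim: "(\<lambda>n. (a (Suc n) - a n) / (b (Suc n) - b n)) \<longlonglongrightarrow> L"
  shows "(\<lambda>n. a n / b n) \<longlonglongrightarrow> L"
proof (rule LIMSEQ_I)
  fix e :: real assume e: "e > 0"
  \<comment> \<open>The increments of \<open>c\<close> are eventually at most \<open>e / 2\<close>
    times those of \<open>b\<close>; telescoping from \<open>N\<close> leaves only the fixed term
    \<open>c N\<close>, which is beaten because \<open>b\<close> is unbounded.\<close>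
  define c where "c n = a n - L * b n" for n
  have "eventually (\<lambda>n. dist ((a (Suc n) - a n) / (b (Suc n) - b n)) L < e / 2) sequentially"
    using tendstoD[OF lim, of "e / 2"] e by simp
  moreover have "eventually (\<lambda>n. b n \<ge> 0) sequentially"
    using lim_b by (simp add: filterlim_at_top)
  ultimately have "eventually (\<lambda>n. \<bar>c (Suc n) - c n\<bar> \<le> e / 2 * (b (Suc n) - b n) \<and> b n \<ge> 0) sequentially"
    using assms(1)
  proof eventually_elim
    case (elim n)
    have "c (Suc n) - c n = ((a (Suc n) - a n) / (b (Suc n) - b n) - L) * (b (Suc n) - b n)"
      using elim by (simp add: c_def field_simps)
    then show ?case
      using elim by (auto simp: dist_real_def abs_mult intro!: mult_right_mono)
  qed
  then obtain N where N: "\<And>n. n \<ge> N \<Longrightarrow> \<bar>c (Suc n) - c n\<bar> \<le> e / 2 * (b (Suc n) - b n)"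
    "\<And>n. n \<ge> N \<Longrightarrow> b n \<ge> 0"
    unfolding eventually_sequentially by blast
  have *: "\<bar>c n - c N\<bar> \<le> e / 2 * (b n - b N)" if "n \<ge> N" for n
    using that
  proof (induction rule: dec_induct)
    case (step n)
    have "\<bar>c (Suc n) - c N\<bar> \<le> \<bar>c (Suc n) - c n\<bar> + \<bar>c n - c N\<bar>" by linarith
    also have "\<dots> \<le> e / 2 * (b (Suc n) - b n) + e / 2 * (b n - b N)"
      using step N(1)[of n] by (intro add_mono) auto
    finally show ?case by (simp add: field_simps)
  qed auto
  have "eventually (\<lambda>n. b n > 2 * \<bar>c N\<bar> / e + 1) sequentially"
    using lim_b by (simp add: filterlim_at_top_dense)
  then have "eventually (\<lambda>n. norm (a n / b n - L) < e) sequentially"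
    using eventually_ge_at_top[of N]
  proof eventually_elim
    case (elim n)
    have "2 * \<bar>c N\<bar> / e \<ge> 0" using e by simp
    then have b: "b n > 0" "2 * \<bar>c N\<bar> < e * b n"
      using elim e by (linarith, simp add: field_simps)
    have "\<bar>c n\<bar> < e * b n"
    proof -
      have "e * b N \<ge> 0" using N(2)[of N] e by simp
      moreover have "2 * \<bar>c n - c N\<bar> \<le> e * b n - e * b N"
        using *[OF elim(2)] by (simp add: field_simps)
      moreover have "\<bar>c n\<bar> \<le> \<bar>c n - c N\<bar> + \<bar>c N\<bar>" by linarith
      moreover have "x < E" if "x \<le> y + z" "0 \<le> w" "2 * y \<le> E - w" "2 * z < E" for x y z w E :: real
        using that by linarith
      ultimately show ?thesis using b(2) by blast
    qed
    moreover have "a n / b n - L = c n / b n" using b by (simp add: c_def field_simps)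
    ultimately show ?case using b by (simp add: field_simps)
  qed
  then show "\<exists>no. \<forall>n\<ge>no. norm (a n / b n - L) < e"
    by (simp add: eventually_sequentially)
qed

text \<open>A constant factor disappears under the logarithm: the quotient equals
  \<open>1 + ln (f x / g x) / ln (g x)\<close>. Applied twice, this replaces the iterated logarithm
  of the variance by one of \<open>n\<close>.\<close>

lemma tendsto_ln_quotient:
  fixes f g :: "'a \<Rightarrow> real"
  assumes lim: "((\<lambda>x. f x / g x) \<longlongrightarrow> c) F" and "c > 0"
    and g: "filterlim g at_top F"
  shows "((\<lambda>x. ln (f x) / ln (g x)) \<longlongrightarrow> 1) F"
proof -
  have lng: "filterlim (\<lambda>x. ln (g x)) at_top F"
    using filterlim_compose[OF ln_at_top g] .
  have "((\<lambda>x. ln (f x / g x)) \<longlongrightarrow> ln c) F"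
    using tendsto_ln[OF lim] \<open>c > 0\<close> by simp
  then have "((\<lambda>x. 1 + ln (f x / g x) / ln (g x)) \<longlongrightarrow> 1 + 0) F"
    by (intro tendsto_intros real_tendsto_divide_at_top[OF _ lng])
  moreover have "eventually (\<lambda>x. 1 + ln (f x / g x) / ln (g x) = ln (f x) / ln (g x)) F"
  proof -
    have "eventually (\<lambda>x. g x > 1) F" using g by (simp add: filterlim_at_top_dense)
    moreover have "eventually (\<lambda>x. f x / g x > 0) F" using order_tendstoD(1)[OF lim \<open>c > 0\<close>] .
    ultimately show ?thesis
    proof eventually_elim
      case (elim x)
      then have "f x > 0" by (simp add: zero_less_divide_iff)
      then show ?case using elim ln_gt_zero[of "g x"] by (simp add: ln_div field_simps)
    qed
  qed
  ultimately show ?thesis by (simp add: tendsto_cong)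
qed

text \<open>The left side is the moment generating function of a centred sign: values
  \<open>1 - m\<close> and \<open>- 1 - m\<close> with probabilities \<open>(1 + m) / 2\<close> and
  \<open>(1 - m) / 2\<close>. This is Hoeffding's lemma for an interval of length 2; negative
  \<open>s\<close> follows from the symmetry that flips \<open>m\<close> and
  \<open>s\<close>.\<close>

lemma cosh_add_sinh_le:
  fixes m s :: real
  assumes "\<bar>m\<bar> \<le> 1"
  shows "(1 + m) / 2 * exp (s * (1 - m)) + (1 - m) / 2 * exp (s * (- 1 - m)) \<le> exp (s\<^sup>2 / 2)"
proof -
  have *: "(1 + m) / 2 * exp (s * (1 - m)) + (1 - m) / 2 * exp (s * (- 1 - m)) \<le> exp (s\<^sup>2 / 2)"
    if "\<bar>m\<bar> \<le> 1" "s \<ge> 0" for m s :: real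
  proof -
    define q where "q = (1 + m) / 2"
    have q: "q \<ge> 0" using that by (simp add: q_def)
    have pos: "1 + q * (exp (2 * s) - 1) > 0"
      using q that by (intro add_pos_nonneg mult_nonneg_nonneg) auto
    have "- (2 * s) * q + ln (1 + q * (exp (2 * s) - 1)) \<le> (2 * s)\<^sup>2 / 8"
      using Hoeffdings_lemma_aux[of "2 * s" q] q that by simp
    then have "exp (- (2 * s) * q + ln (1 + q * (exp (2 * s) - 1))) \<le> exp (s\<^sup>2 / 2)"
      by (simp add: power2_eq_square)
    also have "exp (- (2 * s) * q + ln (1 + q * (exp (2 * s) - 1)))
        = exp (- (2 * s) * q) * (1 + q * (exp (2 * s) - 1))"
      using pos by (simp only: exp_add exp_ln)
    also have "\<dots> = q * exp (2 * s - (2 * s) * q) + (1 - q) * exp (- (2 * s) * q)"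
      by (simp add: algebra_simps exp_diff exp_minus field_simps)
    also have "2 * s - 2 * s * q = s * (1 - m)" by (simp add: q_def field_simps)
    also have "- (2 * s) * q = s * (- 1 - m)" by (simp add: q_def field_simps)
    also have "1 - q = (1 - m) / 2" by (simp add: q_def field_simps)
    finally show ?thesis by (simp add: q_def)
  qed
  show ?thesis
  proof (cases "s \<ge> 0")
    case True
    then show ?thesis using *[OF assms] by blast
  next
    case False
    then show ?thesis using *[of "- m" "- s"] assms by (simp add: algebra_simps)
  qed
qed

text \<open>A Taylor polynomial of odd degree bounds \<open>exp\<close> from below on the whole
  line, as its remainder has an even power. The cubic one still retains the variance.\<close>

lemma exp_ge_cubic: "exp y \<ge> 1 + y + y\<^sup>2 / 2 + y ^ 3 / 6" for y :: real
proof -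
  obtain t where "exp y = (\<Sum>m<4. y ^ m / fact m) + exp t / fact 4 * y ^ 4"
    using Maclaurin_exp_le[of y 4] by auto
  moreover have "exp t / fact 4 * y ^ 4 \<ge> 0" by simp
  ultimately show ?thesis by (simp add: eval_nat_numeral fact_numeral)
qed

text \<open>Reverse of Hoeffding's lemma up to the factor \<open>1 - e\<close>. The drift costs at
  most \<open>e / 2\<close> of the variance \<open>1 - m^2\<close>, and the terms of third order in
  \<open>s\<close> are paid from the rest because \<open>s\<close> is at most
  \<open>e / 8\<close>.\<close>

lemma cosh_add_sinh_ge:
  fixes m s e r :: real
  assumes "\<bar>m\<bar> \<le> r" "r\<^sup>2 \<le> e / 2" "0 \<le> s" "s \<le> e / 8" "0 \<le> e" "e \<le> 1"
  shows "exp ((1 - e) * s\<^sup>2 / 2)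
    \<le> (1 + m) / 2 * exp (s * (1 - m)) + (1 - m) / 2 * exp (s * (- 1 - m))"
proof -
  have m2: "m\<^sup>2 \<le> e / 2"
    using assms power_mono[of "\<bar>m\<bar>" r 2] by simp
  then have "\<bar>m\<bar>\<^sup>2 \<le> 1\<^sup>2" using assms by simp
  then have m1: "\<bar>m\<bar> \<le> 1" by (rule power2_le_imp_le) simp
  define u where "u = (1 - e) * s\<^sup>2 / 2"
  have s2: "s\<^sup>2 \<le> 1" using assms by (simp add: power_le_one)
  have u: "0 \<le> u" "u \<le> s\<^sup>2 / 2"
    using assms by (auto simp: u_def intro!: mult_left_le_one_le)
  have "exp u \<le> 1 + u + u\<^sup>2"
    using u s2 by (intro exp_bound) auto
  also have "u\<^sup>2 \<le> (s\<^sup>2 / 2)\<^sup>2" using u by (intro power_mono) auto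
  also have "(s\<^sup>2 / 2)\<^sup>2 = s\<^sup>2 * s\<^sup>2 / 4" by (simp add: power2_eq_square)
  also have "s\<^sup>2 * s\<^sup>2 / 4 \<le> s\<^sup>2 * (s * (1 / 8)) / 4"
    using assms mult_left_mono[of s "1 / 8" s]
    by (intro divide_right_mono mult_left_mono) (auto simp: power2_eq_square)
  \<comment> \<open>The exact third-order coefficient is \<open>m * (1 - m^2) / 3\<close>; the
    cruder \<open>4 / 3\<close> is affordable, since \<open>4 / 3 + 1 / 32\<close> times
    \<open>e / 8\<close> is below \<open>e / 4\<close>.\<close>
  also have "1 + u + s\<^sup>2 * (s * (1 / 8)) / 4 \<le> 1 + s\<^sup>2 * (1 - m\<^sup>2) / 2 - s\<^sup>2 * (4 / 3 * s)"
  proof -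
    have "(1 - e) / 2 + s / 32 \<le> (1 - m\<^sup>2) / 2 - 4 / 3 * s"
      using m2 assms(3-5) by argo
    from mult_left_mono[OF this, of "s\<^sup>2"] show ?thesis by (simp add: u_def algebra_simps)
  qed
  also have "\<dots> \<le> (1 + m) / 2 * exp (s * (1 - m)) + (1 - m) / 2 * exp (s * (- 1 - m))"
  proof -
    have "(1 + m) / 2 * (1 + s * (1 - m) + (s * (1 - m))\<^sup>2 / 2 + (s * (1 - m)) ^ 3 / 6)
        + (1 - m) / 2 * (1 + s * (- 1 - m) + (s * (- 1 - m))\<^sup>2 / 2 + (s * (- 1 - m)) ^ 3 / 6)
        \<le> (1 + m) / 2 * exp (s * (1 - m)) + (1 - m) / 2 * exp (s * (- 1 - m))"
      using m1 by (intro add_mono mult_left_mono exp_ge_cubic) auto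
    also have "(1 + m) / 2 * (1 + s * (1 - m) + (s * (1 - m))\<^sup>2 / 2 + (s * (1 - m)) ^ 3 / 6)
        + (1 - m) / 2 * (1 + s * (- 1 - m) + (s * (- 1 - m))\<^sup>2 / 2 + (s * (- 1 - m)) ^ 3 / 6)
        = 1 + s\<^sup>2 * (1 - m\<^sup>2) / 2 - s\<^sup>2 * (s * (m * (1 - m\<^sup>2) / 3))"
      by (simp add: power2_eq_square power3_eq_cube field_simps) 
    finally have "1 + s\<^sup>2 * (1 - m\<^sup>2) / 2 - s\<^sup>2 * (s * (m * (1 - m\<^sup>2) / 3))
      \<le> (1 + m) / 2 * exp (s * (1 - m)) + (1 - m) / 2 * exp (s * (- 1 - m))" .
    moreover have "s\<^sup>2 * (s * (m * (1 - m\<^sup>2) / 3)) \<le> s\<^sup>2 * (s * (4 / 3))"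
    proof -
      have "m * (1 - m\<^sup>2) \<le> \<bar>m\<bar> * (1 - m\<^sup>2)"
        using m1 by (intro mult_right_mono) (auto simp: abs_square_le_1)
      also have "\<dots> \<le> 1 * 1" using m1 by (intro mult_mono) (auto simp: abs_square_le_1)
      finally show ?thesis using assms by (intro mult_left_mono) auto
    qed
    ultimately show ?thesis by (simp add: mult_ac)
  qed
  finally show ?thesis by (simp add: u_def)
qed

section \<open>The normalising function and the geometric scale\<close>

definition lil_norm :: "real \<Rightarrow> real" where
  "lil_norm v = sqrt (2 * v * ln (ln v))"

lemma lnln_mono:
  fixes v w :: real
  assumes "exp 1 \<le> v" "v \<le> w"
  shows "0 \<le> ln (ln v)" "ln (ln v) \<le> ln (ln w)"
proof -
  have "0 < v" using assms(1) exp_gt_zero[of "1::real"] by linarith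
  then have "1 \<le> ln v" "ln v \<le> ln w" using assms by (auto simp: ln_ge_iff)
  then show "0 \<le> ln (ln v)" "ln (ln v) \<le> ln (ln w)" by auto
qed

lemma lil_norm_mono:
  assumes "exp 1 \<le> v" "v \<le> w"
  shows "lil_norm v \<le> lil_norm w"
proof -
  have "0 < v" using assms(1) exp_gt_zero[of "1::real"] by linarith
  then show ?thesis
    unfolding lil_norm_def using lnln_mono[OF assms] assms
    by (intro real_sqrt_le_mono mult_mono) auto
qed

lemma lil_norm_at_top: "filterlim lil_norm at_top at_top"
  unfolding lil_norm_def by real_asymp

lemma power_at_top: "b > 1 \<Longrightarrow> filterlim (\<lambda>j. b ^ j) at_top sequentially" for b :: real
  by real_asymp

lemma ex_power_ivl:
  fixes b x :: real
  assumes "b > 1" "x \<ge> b ^ J"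
  obtains j where "j \<ge> J" "b ^ j \<le> x" "x < b ^ Suc j"
proof -
  define m where "m = (LEAST m. x < b ^ m)"
  obtain m0 where "x < b ^ m0" using real_arch_pow[OF assms(1)] by blast
  then have m: "x < b ^ m" unfolding m_def by (rule LeastI)
  then have "b ^ J < b ^ m" using assms(2) by linarith
  then have "J < m" using assms(1) by simp
  then obtain j where j: "m = Suc j" by (cases m) auto
  moreover have "\<not> x < b ^ j"
    using not_less_Least[of j "\<lambda>m. x < b ^ m"] j by (simp add: m_def)
  ultimately show ?thesis using m \<open>J < m\<close> that[of j] by auto
qed

subsection \<open>Asymptotics of the scaling factor\<close>

text \<open>
  With \<open>s = 2 * p - 1\<close>, the conditional mean of the position at time \<open>n + 1\<close> is \<open>1 + s / n\<close> times
  the position at time \<open>n\<close>; the product of the inverse factors turns the walk into a martingale.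
\<close>

definition erw_scale :: "real \<Rightarrow> nat \<Rightarrow> real" where
  "erw_scale s n = (\<Prod>k=1..<n. real k / (real k + s))"

definition erw_var :: "real \<Rightarrow> nat \<Rightarrow> real" where
  "erw_var s n = (\<Sum>k=1..n. (erw_scale s k)\<^sup>2)"

lemma erw_var_Suc: "erw_var s (Suc n) = erw_var s n + (erw_scale s (Suc n))\<^sup>2"
  by (simp add: erw_var_def)

lemma erw_var_mono: "m \<le> n \<Longrightarrow> erw_var s m \<le> erw_var s n"
  by (auto simp: erw_var_def intro!: sum_mono2)

context
  fixes s :: real
  assumes s_gt: "s > -1"
begin

lemma erw_scale_1 [simp]: "erw_scale s (Suc 0) = 1"
  by (simp add: erw_scale_def)

lemma erw_scale_pos: "erw_scale s n > 0"
  unfolding erw_scale_def using s_gt by (intro prod_pos) (auto simp: zero_less_divide_iff)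

lemma erw_scale_Suc: "n \<ge> 1 \<Longrightarrow> erw_scale s n = erw_scale s (Suc n) * (1 + s / real n)"
proof -
  assume n: "n \<ge> 1"
  have "1 + s / real n = (real n + s) / real n" "real n + s \<noteq> 0"
    using n s_gt by (auto simp: field_simps)
  then have "real n / (real n + s) * (1 + s / real n) = 1"
    using n by (simp only: times_divide_times_eq) simp
  moreover have "erw_scale s (Suc n) = erw_scale s n * (real n / (real n + s))"
    using n by (simp add: erw_scale_def)
  ultimately show ?thesis
    by (simp only: mult.assoc mult_1_right)
qed

text \<open>The scale decreases from \<open>1\<close> when \<open>s\<close> is nonnegative and
  increases otherwise, so one quantity at the right end of a block controls all increments in
  it.\<close>

lemma erw_scale_le_max:
  assumes "1 \<le> k" "k \<le> n"
  shows "(erw_scale s k)\<^sup>2 \<le> max 1 ((erw_scale s n)\<^sup>2)"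
proof (cases "s \<ge> 0")
  case True
  have "erw_scale s k \<le> 1"
    unfolding erw_scale_def using True by (intro prod_le_1) auto
  then show ?thesis
    using erw_scale_pos[of k] by (auto simp: le_max_iff_disj abs_square_le_1)
next
  case False
  have "erw_scale s k \<le> erw_scale s n"
    using assms(2)
  proof (induction rule: dec_induct)
    case (step i)
    have "1 + s / real i \<le> 1" using False by (simp add: divide_nonpos_nonneg)
    then have "erw_scale s (Suc i) * (1 + s / real i) \<le> erw_scale s (Suc i) * 1"
      using erw_scale_pos[of "Suc i"] by (intro mult_left_mono) auto
    then show ?case using step assms erw_scale_Suc[of i] by simp
  qed auto
  then show ?thesis
    using erw_scale_pos[of k] by (auto simp: le_max_iff_disj intro!: power_mono)
qed

lemma erw_var_ge_1: "n \<ge> 1 \<Longrightarrow> erw_var s n \<ge> 1"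
  using erw_var_mono[of 1 n s] by (simp add: erw_var_def)

text \<open>With the index shifted by one, the product is
  \<open>fact n / pochhammer (1 + s) n\<close>, which is the Gamma series at \<open>1 + s\<close> up
  to the factor \<open>n / (s + n)\<close>.\<close>

lemma erw_scale_asymp: "(\<lambda>n. erw_scale s n * real n powr s) \<longlonglongrightarrow> Gamma (1 + s)"
proof -
  have nz: "pochhammer (1 + s) n \<noteq> 0" for n
    using pochhammer_pos[of "1 + s" n] s_gt by simp
  have eq: "erw_scale s (Suc n) = fact n / pochhammer (1 + s) n" for n
  proof (induction n)
    case (Suc n)
    have "erw_scale s (Suc (Suc n)) = erw_scale s (Suc n) * (real (Suc n) / (1 + s + real n))"
      by (simp add: erw_scale_def add_ac)
    then show ?case by (simp add: Suc.IH pochhammer_Suc fact_Suc mult_ac)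
  qed auto
  have "(\<lambda>n. Gamma_series' (1 + s) n * ((s + real n) / real n)) \<longlonglongrightarrow> Gamma (1 + s) * 1"
    by (intro tendsto_mult Gamma_series'_LIMSEQ) real_asymp
  moreover have "eventually (\<lambda>n. Gamma_series' (1 + s) n * ((s + real n) / real n) = erw_scale s n * real n powr s) sequentially"
    using eventually_gt_at_top[of 0]
  proof eventually_elim
    case (elim n)
    then obtain k where k: "n = Suc k" by (cases n) auto
    have "exp ((1 + s) * ln (real n)) = real n * real n powr s"
      using elim by (simp add: powr_def exp_add algebra_simps)
    moreover have [simp]: "s + real (Suc k) = 1 + s + real k" "1 + s + real k \<noteq> 0"
      using s_gt by simp_all
    ultimately show ?case
      using nz[of k]
      by (simp add: Gamma_series'_def k pochhammer_Suc eq nonzero_divide_mult_cancel_right del: of_nat_Suc)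
  qed
  ultimately show ?thesis by (simp add: tendsto_cong)
qed

lemma erw_scale_sq_asymp: "(\<lambda>n. (erw_scale s n)\<^sup>2 * real n powr (2 * s)) \<longlonglongrightarrow> (Gamma (1 + s))\<^sup>2"
proof -
  have "(\<lambda>n. (erw_scale s n * real n powr s)\<^sup>2) \<longlonglongrightarrow> (Gamma (1 + s))\<^sup>2"
    by (intro tendsto_power erw_scale_asymp)
  moreover have "(real n powr s)\<^sup>2 = real n powr (2 * s)" for n
    by (simp add: power2_eq_square flip: powr_add)
  ultimately show ?thesis by (simp add: power_mult_distrib)
qed

lemma Gamma_sq_pos: "(Gamma (1 + s))\<^sup>2 > 0"
  using Gamma_real_pos[of "1 + s"] s_gt by (intro zero_less_power) simp

text \<open>Stolz-Cesaro: the increments behave like a constant times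
  \<open>n powr (- 2 * s)\<close>, those of \<open>n powr (1 - 2 * s)\<close> like
  \<open>(1 - 2 * s)\<close> times the same power. The factor \<open>1 - 2 * s\<close> is
  \<open>3 - 4 * p\<close>, the source of the constant in the diffusive case.\<close>

lemma erw_var_asymp_diffusive:
  assumes "s < 1 / 2"
  shows "(\<lambda>n. erw_var s n / real n powr (1 - 2 * s)) \<longlonglongrightarrow> (Gamma (1 + s))\<^sup>2 / (1 - 2 * s)"
proof (rule stolz_cesaro)
  have pos: "1 - 2 * s > 0" using assms by simp
  show "eventually (\<lambda>n. real n powr (1 - 2 * s) < real (Suc n) powr (1 - 2 * s)) sequentially"
    using pos by (auto intro!: always_eventually powr_less_mono2)
  show "filterlim (\<lambda>n. real n powr (1 - 2 * s)) at_top sequentially"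
    using pos by real_asymp
  define t where "t = 1 - 2 * s"
  have t: "t > 0" using pos by (simp add: t_def)
  have "(\<lambda>n. ((erw_scale s (Suc n))\<^sup>2 * real (Suc n) powr (2 * s))
      * (real (Suc n) powr (t - 1) / (real (Suc n) powr t - real n powr t))) \<longlonglongrightarrow> (Gamma (1 + s))\<^sup>2 * (1 / t)"
    using t by (intro tendsto_mult LIMSEQ_Suc[OF erw_scale_sq_asymp]) (real_asymp simp: inverse_eq_divide)
  moreover have "real (Suc n) powr (2 * s) * real (Suc n) powr (t - 1) = 1" for n
    by (simp add: t_def flip: powr_add)
  ultimately show "(\<lambda>n. (erw_var s (Suc n) - erw_var s n) / (real (Suc n) powr (1 - 2 * s) - real n powr (1 - 2 * s)))
    \<longlonglongrightarrow> (Gamma (1 + s))\<^sup>2 / (1 - 2 * s)"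
    by (simp add: erw_var_Suc t_def mult.assoc)
qed

lemma erw_var_asymp_critical:
  assumes "s = 1 / 2"
  shows "(\<lambda>n. erw_var s n / ln (real n)) \<longlonglongrightarrow> (Gamma (1 + s))\<^sup>2"
proof (rule stolz_cesaro)
  show "eventually (\<lambda>n. ln (real n) < ln (real (Suc n))) sequentially"
    using eventually_gt_at_top[of 0] by eventually_elim simp
  show "filterlim (\<lambda>n. ln (real n)) at_top sequentially"
    by real_asymp
  have "(\<lambda>n. ((erw_scale s (Suc n))\<^sup>2 * real (Suc n) powr (2 * s))
      * (1 / real (Suc n) / (ln (real (Suc n)) - ln (real n)))) \<longlonglongrightarrow> (Gamma (1 + s))\<^sup>2 * 1"
    by (intro tendsto_mult LIMSEQ_Suc[OF erw_scale_sq_asymp]) real_asymp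
  moreover have "real (Suc n) powr (2 * s) * (1 / real (Suc n)) = 1" for n
    by (simp add: assms)
  ultimately show "(\<lambda>n. (erw_var s (Suc n) - erw_var s n) / (ln (real (Suc n)) - ln (real n)))
    \<longlonglongrightarrow> (Gamma (1 + s))\<^sup>2"
    by (simp add: erw_var_Suc mult.assoc del: of_nat_Suc)
qed

end

subsection \<open>The martingale of the walk\<close>

context elephant_random_walk
begin

text \<open>This is the conditional mean of step \<open>n + 1\<close> given the first
  \<open>n\<close> steps; hence the index \<open>n - 1\<close> in \<open>incr\<close>.\<close>

definition drift :: "nat \<Rightarrow> 'a \<Rightarrow> real" where
  "drift n \<omega> = (2 * p - 1) * real_of_int (erw_position \<eta> n \<omega>) / real n"

definition incr :: "nat \<Rightarrow> 'a \<Rightarrow> real" where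
  "incr n \<omega> = erw_scale (2 * p - 1) n * (real_of_int (\<eta> n \<omega>) - drift (n - 1) \<omega>)"

text \<open>Whether step \<open>k\<close> counts is decided by \<open>drift (k - 1)\<close>, so the
  truncation is predictable and the retained increments are still martingale differences.
  \<open>bad_var\<close> charges a rejected step with the variance it would have had at drift
  \<open>0\<close>.\<close>

definition good_sum :: "real \<Rightarrow> nat \<Rightarrow> nat \<Rightarrow> 'a \<Rightarrow> real" where
  "good_sum r m n \<omega> = (\<Sum>k\<in>{m<..n}. if \<bar>drift (k - 1) \<omega>\<bar> \<le> r then incr k \<omega> else 0)"

definition bad_var :: "real \<Rightarrow> nat \<Rightarrow> nat \<Rightarrow> 'a \<Rightarrow> real" where
  "bad_var r m n \<omega> = (\<Sum>k\<in>{m<..n}. if \<bar>drift (k - 1) \<omega>\<bar> \<le> r then 0 else (erw_scale (2 * p - 1) k)\<^sup>2)"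

text \<open>The sum starts at 2 because the first step is not centred; it enters separately as a
  bounded term.\<close>

definition mart :: "nat \<Rightarrow> 'a \<Rightarrow> real" where
  "mart n \<omega> = (\<Sum>k\<in>{1<..n}. incr k \<omega>)"

section \<open>Measurability with respect to the history, and the martingale decomposition\<close>

lemma space_history [simp]: "space (erw_history M \<eta> n) = space M"
  using erw_history_subalgebra by (simp add: subalgebra_def)

lemma step_measurable_history:
  assumes "1 \<le> k" "k \<le> n"
  shows "\<eta> k \<in> measurable (erw_history M \<eta> n) (count_space UNIV)"
proof (rule measurableI)
  fix A :: "int set"
  have "\<eta> k -` A \<inter> space M \<in> {\<eta> k -` A \<inter> space M | k A. k \<in> {1..n}}"
    using assms by auto
  then show "\<eta> k -` A \<inter> space (erw_history M \<eta> n) \<in> sets (erw_history M \<eta> n)"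
    unfolding space_history by (auto simp: erw_history_def sets_measure_of_conv)
qed auto

lemma sets_history_mono:
  assumes "m \<le> n"
  shows "sets (erw_history M \<eta> m) \<subseteq> sets (erw_history M \<eta> n)"
proof -
  have "sigma_sets (space M) {\<eta> k -` A \<inter> space M | k A. k \<in> {1..m}}
      \<subseteq> sigma_sets (space M) {\<eta> k -` A \<inter> space M | k A. k \<in> {1..n}}"
    by (rule sigma_sets_mono') (use assms in force)
  then show ?thesis
    by (subst (1 2) erw_history_def) (auto simp: sets_measure_of_conv)
qed

lemma sets_history: "A \<in> sets (erw_history M \<eta> n) \<Longrightarrow> A \<in> sets M"
  using erw_history_subalgebra by (auto simp: subalgebra_def)

lemma drift_measurable:
  assumes "k \<le> n"
  shows "drift k \<in> borel_measurable (erw_history M \<eta> n)"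
proof -
  have [measurable]: "\<And>i. i \<in> {1..k} \<Longrightarrow> \<eta> i \<in> measurable (erw_history M \<eta> n) (count_space UNIV)"
    using assms by (auto intro: step_measurable_history)
  show ?thesis
    unfolding drift_def erw_position_def of_int_sum by measurable
qed

lemma incr_measurable:
  assumes "1 \<le> k" "k \<le> n"
  shows "incr k \<in> borel_measurable (erw_history M \<eta> n)"
proof -
  note [measurable] = step_measurable_history[OF assms] drift_measurable[of "k - 1" n, OF diff_le_self[THEN order_trans, OF assms(2)]]
  show ?thesis
    unfolding incr_def by measurable
qed

lemma block_measurable:
  assumes "1 \<le> m"
  shows "good_sum r m n \<in> borel_measurable (erw_history M \<eta> n)"
    and "bad_var r m n \<in> borel_measurable (erw_history M \<eta> n)"
proof -
  have [measurable]: "incr k \<in> borel_measurable (erw_history M \<eta> n)"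
      "drift (k - 1) \<in> borel_measurable (erw_history M \<eta> n)" if "k \<in> {m<..n}" for k
    using that assms by (auto intro: incr_measurable drift_measurable)
  show "good_sum r m n \<in> borel_measurable (erw_history M \<eta> n)"
    unfolding good_sum_def by measurable
  show "bad_var r m n \<in> borel_measurable (erw_history M \<eta> n)"
    unfolding bad_var_def by measurable
qed

lemma mart_measurable:
  assumes "k \<le> n"
  shows "mart k \<in> borel_measurable (erw_history M \<eta> n)"
proof -
  have [measurable]: "incr i \<in> borel_measurable (erw_history M \<eta> n)" if "i \<in> {1<..k}" for i
    using that assms by (auto intro: incr_measurable)
  show ?thesis unfolding mart_def by measurable
qed

lemma mart_1 [simp]: "mart (Suc 0) \<omega> = 0"
  by (simp add: mart_def)

lemma mart_Suc: "n \<ge> 1 \<Longrightarrow> mart (Suc n) \<omega> = mart n \<omega> + incr (Suc n) \<omega>"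
proof -
  assume "n \<ge> 1"
  then have "{1<..Suc n} = insert (Suc n) {1<..n}" by auto
  then show ?thesis by (simp add: mart_def)
qed

text \<open>The recursion of the scale absorbs the factor \<open>1 + (2 * p - 1) / n\<close> of the
  conditional mean, so each step adds exactly one centred increment.\<close>

lemma scale_position_eq:
  assumes "p > 0" "n \<ge> 1"
  shows "erw_scale (2 * p - 1) n * real_of_int (erw_position \<eta> n \<omega>) = real_of_int (\<eta> 1 \<omega>) + mart n \<omega>"
  using assms(2)
proof (induction rule: dec_induct)
  case base
  then show ?case using erw_scale_1[of "2 * p - 1"] assms by (simp add: erw_position_def)
next
  case (step n)
  define c X where "c = erw_scale (2 * p - 1) (Suc n)" and "X = real_of_int (erw_position \<eta> n \<omega>)"
  have "c * (1 + (2 * p - 1) / real n) * X = real_of_int (\<eta> 1 \<omega>) + mart n \<omega>"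
    using step erw_scale_Suc[of "2 * p - 1" n] assms by (simp add: c_def X_def)
  moreover have "real_of_int (erw_position \<eta> (Suc n) \<omega>) = X + real_of_int (\<eta> (Suc n) \<omega>)"
    by (simp add: X_def erw_position_def)
  ultimately show ?case
    using step mart_Suc[of n \<omega>]
    by (simp add: incr_def drift_def flip: c_def X_def) (simp add: field_simps)
qed

text \<open>The squares summed in \<open>bad_var\<close> are strictly positive, so a vanishing sum
  means that no step of the block was rejected.\<close>

lemma mart_block_eq:
  assumes "1 \<le> m" "m \<le> n" "bad_var r m n \<omega> \<le> 0" "p > 0"
  shows "mart n \<omega> = mart m \<omega> + good_sum r m n \<omega>"
proof -
  have "bad_var r m n \<omega> \<ge> 0" unfolding bad_var_def by (intro sum_nonneg) auto
  then have "bad_var r m n \<omega> = 0" using assms by simp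
  then have "\<bar>drift (k - 1) \<omega>\<bar> \<le> r" if "k \<in> {m<..n}" for k
    using that erw_scale_pos[of "2 * p - 1" k] \<open>p > 0\<close> unfolding bad_var_def
    by (subst (asm) sum_nonneg_eq_0_iff) (auto split: if_splits)
  then have "good_sum r m n \<omega> = (\<Sum>k\<in>{m<..n}. incr k \<omega>)"
    unfolding good_sum_def by (intro sum.cong) auto
  moreover have "{1<..n} = {1<..m} \<union> {m<..n}" using assms by auto
  ultimately show ?thesis
    unfolding mart_def by (simp add: sum.union_disjoint)
qed

section \<open>The conditional law of one step\<close>

lemma abs_position_le:
  assumes "\<omega> \<in> space M"
  shows "\<bar>real_of_int (erw_position \<eta> n \<omega>)\<bar> \<le> real n"
proof -
  have "\<bar>real_of_int (erw_position \<eta> n \<omega>)\<bar> \<le> (\<Sum>k=1..n. \<bar>real_of_int (\<eta> k \<omega>)\<bar>)"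
    unfolding erw_position_def of_int_sum by (rule sum_abs)
  also have "\<dots> \<le> (\<Sum>k=1..n. 1)"
    using step_values[OF _ assms] by (intro sum_mono) force
  finally show ?thesis by simp
qed

lemma abs_drift_le_1:
  assumes "0 \<le> p" "p \<le> 1" "n \<ge> 1" "\<omega> \<in> space M"
  shows "\<bar>drift n \<omega>\<bar> \<le> 1"
proof -
  have "\<bar>2 * p - 1\<bar> * \<bar>real_of_int (erw_position \<eta> n \<omega>)\<bar> \<le> 1 * real n"
    using assms abs_position_le[OF assms(4)] by (intro mult_mono) auto
  then show ?thesis using assms by (simp add: drift_def abs_mult)
qed

text \<open>Rewrites the conditional law as an identity of nonnegative integrals against an
  arbitrary weight from the past; in this form no integrability has to be checked later.\<close>

lemma nn_integral_step_eq:
  assumes p01: "0 \<le> p" "p \<le> 1" and n: "n \<ge> 1" and s: "s \<in> {-1, 1}"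
    and H [measurable]: "H \<in> borel_measurable (erw_history M \<eta> n)"
  shows "(\<integral>\<^sup>+\<omega>. H \<omega> * indicator {\<omega> \<in> space M. \<eta> (Suc n) \<omega> = s} \<omega> \<partial>M)
    = (\<integral>\<^sup>+\<omega>. H \<omega> * ennreal ((1 + real_of_int s * drift n \<omega>) / 2) \<partial>M)"
proof -
  let ?F = "erw_history M \<eta> n"
  interpret F: finite_measure_subalgebra M ?F
    by unfold_locales (rule erw_history_subalgebra)
  note [measurable] = step_measurable[of "Suc n"]
  define A where "A = {\<omega> \<in> space M. \<eta> (Suc n) \<omega> = s}"
  have A [measurable]: "A \<in> sets M" unfolding A_def by measurable
  let ?g = "indicator A :: 'a \<Rightarrow> real"
  \<comment> \<open>\<open>real_cond_exp\<close> is a difference of values of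
    \<open>enn2real\<close>, which sends infinity to 0. To recover \<open>nn_cond_exp\<close> from
    it, the positive part is bounded by the conditional expectation of \<open>1\<close>, and the
    negative part is that of \<open>0\<close>.\<close>
  have "AE \<omega> in M. nn_cond_exp M ?F (\<lambda>x. ennreal (?g x)) \<omega> \<le> nn_cond_exp M ?F (\<lambda>_. 1) \<omega>"
    by (rule F.nn_cond_exp_mono) (auto simp: indicator_def)
  moreover have "AE \<omega> in M. 1 = nn_cond_exp M ?F (\<lambda>_. 1) \<omega>"
    by (rule F.nn_cond_exp_F_meas) simp
  moreover have "AE \<omega> in M. 0 = nn_cond_exp M ?F (\<lambda>_. 0) \<omega>"
    by (rule F.nn_cond_exp_F_meas) simp
  moreover have "AE \<omega> in M. real_cond_exp M ?F ?g \<omega> = pmf (erw_next_step p n (\<lambda>k. \<eta> k \<omega>)) s"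
    using next_step[OF n s] by (simp add: A_def)
  ultimately have "AE \<omega> in M. nn_cond_exp M ?F (\<lambda>x. ennreal (?g x)) \<omega> = ennreal ((1 + real_of_int s * drift n \<omega>) / 2)"
    using AE_space
  proof eventually_elim
    case (elim \<omega>)
    let ?c = "nn_cond_exp M ?F (\<lambda>x. ennreal (?g x)) \<omega>"
    have "?c < \<top>"
      using elim(1) by (simp flip: elim(2)) (auto simp: less_top[symmetric] top_unique)
    moreover have "(\<lambda>x. ennreal (- ?g x)) = (\<lambda>_. 0)" by (auto simp: ennreal_neg)
    then have "real_cond_exp M ?F ?g \<omega> = enn2real ?c"
      using elim(3) by (simp add: real_cond_exp_def)
    ultimately have "?c = ennreal (pmf (erw_next_step p n (\<lambda>k. \<eta> k \<omega>)) s)"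
      using elim(4) by (metis ennreal_enn2real)
    also have "pmf (erw_next_step p n (\<lambda>k. \<eta> k \<omega>)) s
      = 1 / (2 * real n) * (\<Sum>k=1..n. 1 + (2 * p - 1) * real_of_int (\<eta> k \<omega>) * real_of_int s)"
      using step_values[OF _ elim(5)] s by (intro pmf_erw_next_step[OF n p01]) auto
    also have "(\<Sum>k=1..n. 1 + (2 * p - 1) * real_of_int (\<eta> k \<omega>) * real_of_int s)
        = real n + (2 * p - 1) * real_of_int (erw_position \<eta> n \<omega>) * real_of_int s"
      by (simp add: sum.distrib erw_position_def sum_distrib_left sum_distrib_right)
    also have "1 / (2 * real n) * \<dots> = (1 + real_of_int s * drift n \<omega>) / 2"
      using n by (simp add: drift_def field_simps)
    finally show ?case .
  qed
  then have "(\<integral>\<^sup>+\<omega>. H \<omega> * ennreal ((1 + real_of_int s * drift n \<omega>) / 2) \<partial>M)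
      = (\<integral>\<^sup>+\<omega>. H \<omega> * nn_cond_exp M ?F (\<lambda>x. ennreal (?g x)) \<omega> \<partial>M)"
    by (intro nn_integral_cong_AE) auto
  also have "\<dots> = (\<integral>\<^sup>+\<omega>. H \<omega> * ennreal (?g \<omega>) \<partial>M)"
    by (rule F.nn_cond_exp_intg) auto
  finally show ?thesis by (simp add: A_def ennreal_indicator)
qed

lemma nn_integral_step:
  fixes Y :: "'a \<Rightarrow> ennreal"
  assumes p01: "0 \<le> p" "p \<le> 1" and n: "n \<ge> 1"
    and Y: "Y \<in> borel_measurable (erw_history M \<eta> n)"
  defines "c \<equiv> erw_scale (2 * p - 1) (Suc n)"
  shows "(\<integral>\<^sup>+\<omega>. Y \<omega> * ennreal (exp (l * incr (Suc n) \<omega>)) \<partial>M)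
    = (\<integral>\<^sup>+\<omega>. Y \<omega> * ennreal ((1 + drift n \<omega>) / 2 * exp (l * c * (1 - drift n \<omega>))
        + (1 - drift n \<omega>) / 2 * exp (l * c * (- 1 - drift n \<omega>))) \<partial>M)"
proof -
  note [measurable] = Y drift_measurable[OF order_refl, of n] step_measurable[of "Suc n"]
    measurable_from_subalg[OF erw_history_subalgebra Y]
    measurable_from_subalg[OF erw_history_subalgebra drift_measurable[OF order_refl, of n]]
  \<comment> \<open>The integrand with the next step frozen at \<open>s\<close>; it is measurable in
    the past, so the one-step identity applies to each of the two values.\<close>
  define H where "H s \<omega> = Y \<omega> * ennreal (exp (l * c * (s - drift n \<omega>)))" for s :: real and \<omega>
  have Hm [measurable]: "H s \<in> borel_measurable (erw_history M \<eta> n)" for s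
    unfolding H_def by measurable
  have HM [measurable]: "H s \<in> borel_measurable M" for s
    using measurable_from_subalg[OF erw_history_subalgebra Hm] .
  have "(\<integral>\<^sup>+\<omega>. Y \<omega> * ennreal (exp (l * incr (Suc n) \<omega>)) \<partial>M)
    = (\<integral>\<^sup>+\<omega>. H 1 \<omega> * indicator {\<omega> \<in> space M. \<eta> (Suc n) \<omega> = 1} \<omega>
        + H (-1) \<omega> * indicator {\<omega> \<in> space M. \<eta> (Suc n) \<omega> = -1} \<omega> \<partial>M)"
    using step_values[of "Suc n"]
    by (intro nn_integral_cong) (force simp: H_def incr_def c_def mult.assoc)
  also have "\<dots> = (\<integral>\<^sup>+\<omega>. H 1 \<omega> * ennreal ((1 + real_of_int 1 * drift n \<omega>) / 2) \<partial>M)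
      + (\<integral>\<^sup>+\<omega>. H (-1) \<omega> * ennreal ((1 + real_of_int (-1) * drift n \<omega>) / 2) \<partial>M)"
    by (subst nn_integral_add, measurable)
      (intro arg_cong2[where f = "(+)"] nn_integral_step_eq[OF p01 n] Hm, auto)
  also have "\<dots> = (\<integral>\<^sup>+\<omega>. H 1 \<omega> * ennreal ((1 + real_of_int 1 * drift n \<omega>) / 2)
      + H (-1) \<omega> * ennreal ((1 + real_of_int (-1) * drift n \<omega>) / 2) \<partial>M)"
    by (subst nn_integral_add, measurable)
  also have "\<dots> = (\<integral>\<^sup>+\<omega>. Y \<omega> * ennreal ((1 + drift n \<omega>) / 2 * exp (l * c * (1 - drift n \<omega>))
        + (1 - drift n \<omega>) / 2 * exp (l * c * (- 1 - drift n \<omega>))) \<partial>M)"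
  proof (intro nn_integral_cong)
    fix \<omega> assume "\<omega> \<in> space M"
    then have "\<bar>drift n \<omega>\<bar> \<le> 1" by (rule abs_drift_le_1[OF p01 n])
    then show "H 1 \<omega> * ennreal ((1 + real_of_int 1 * drift n \<omega>) / 2)
      + H (-1) \<omega> * ennreal ((1 + real_of_int (-1) * drift n \<omega>) / 2)
      = Y \<omega> * ennreal ((1 + drift n \<omega>) / 2 * exp (l * c * (1 - drift n \<omega>))
        + (1 - drift n \<omega>) / 2 * exp (l * c * (- 1 - drift n \<omega>)))"
      by (subst ennreal_plus) (auto simp: H_def ennreal_mult distrib_left mult_ac simp flip: ennreal_mult)
  qed
  finally show ?thesis .
qed

lemma nn_integral_step_le:
  assumes "0 \<le> p" "p \<le> 1" "n \<ge> 1" "Y \<in> borel_measurable (erw_history M \<eta> n)"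
  shows "(\<integral>\<^sup>+\<omega>. Y \<omega> * ennreal (exp (l * incr (Suc n) \<omega>)) \<partial>M)
    \<le> (\<integral>\<^sup>+\<omega>. Y \<omega> * ennreal (exp (l\<^sup>2 * (erw_scale (2 * p - 1) (Suc n))\<^sup>2 / 2)) \<partial>M)"
  unfolding nn_integral_step[OF assms]
  using cosh_add_sinh_le[OF abs_drift_le_1[OF assms(1-3)], of _ "l * erw_scale (2 * p - 1) (Suc n)"]
  by (intro nn_integral_mono mult_left_mono ennreal_leI) (auto simp: power_mult_distrib)

text \<open>The drift bound is required only where the weight is nonzero: the weight will carry the
  indicator of small drift.\<close>

lemma nn_integral_step_ge:
  assumes "0 \<le> p" "p \<le> 1" "n \<ge> 1" "Y \<in> borel_measurable (erw_history M \<eta> n)"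
    and "\<And>\<omega>. \<omega> \<in> space M \<Longrightarrow> Y \<omega> \<noteq> 0 \<Longrightarrow> \<bar>drift n \<omega>\<bar> \<le> r"
    and "r\<^sup>2 \<le> e / 2" "0 \<le> l * erw_scale (2 * p - 1) (Suc n)"
      "l * erw_scale (2 * p - 1) (Suc n) \<le> e / 8" "0 \<le> e" "e \<le> 1"
  shows "(\<integral>\<^sup>+\<omega>. Y \<omega> * ennreal (exp ((1 - e) * l\<^sup>2 * (erw_scale (2 * p - 1) (Suc n))\<^sup>2 / 2)) \<partial>M)
    \<le> (\<integral>\<^sup>+\<omega>. Y \<omega> * ennreal (exp (l * incr (Suc n) \<omega>)) \<partial>M)"
  unfolding nn_integral_step[OF assms(1-4)]
proof (intro nn_integral_mono)
  fix \<omega> assume "\<omega> \<in> space M"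
  then show "Y \<omega> * ennreal (exp ((1 - e) * l\<^sup>2 * (erw_scale (2 * p - 1) (Suc n))\<^sup>2 / 2))
    \<le> Y \<omega> * ennreal ((1 + drift n \<omega>) / 2 * exp (l * erw_scale (2 * p - 1) (Suc n) * (1 - drift n \<omega>))
        + (1 - drift n \<omega>) / 2 * exp (l * erw_scale (2 * p - 1) (Suc n) * (- 1 - drift n \<omega>)))"
    using cosh_add_sinh_ge[OF assms(5-10), of \<omega>]
    by (cases "Y \<omega> = 0") (auto intro!: mult_left_mono ennreal_leI simp: power_mult_distrib mult.assoc)
qed

section \<open>Maximal inequalities\<close>

lemma history_measurable_M [measurable_dest]:
  "f \<in> borel_measurable (erw_history M \<eta> n) \<Longrightarrow> f \<in> borel_measurable M"
  by (rule measurable_from_subalg[OF erw_history_subalgebra])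

lemma mart_measurable_M [measurable]: "mart k \<in> borel_measurable M"
  using mart_measurable[OF order_refl] by (rule history_measurable_M)

text \<open>Ville's inequality for the exponential supermartingale \<open>Z\<close>, which starts
  below \<open>1\<close> because \<open>mart\<close> is \<open>0\<close> at time 1.\<close>

lemma exp_mart_maximal:
  fixes l c :: real
  assumes p01: "0 < p" "p < 1" and n: "n \<ge> 1" and c: "c > 0"
  defines "Z \<equiv> \<lambda>k \<omega>. exp (l * mart k \<omega> - l\<^sup>2 * erw_var (2 * p - 1) k / 2)"
  shows "prob {\<omega> \<in> space M. \<exists>k\<in>{1..n}. Z k \<omega> \<ge> c} \<le> 1 / c"
proof -
  have Zm: "Z k \<in> borel_measurable (erw_history M \<eta> n)" if "k \<le> n" for k n
  proof -
    note [measurable] = mart_measurable[OF that]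
    show ?thesis unfolding Z_def by measurable
  qed
  have [measurable]: "Z k \<in> borel_measurable M" for k
    using Zm[OF order_refl] by (rule history_measurable_M)
  define hit where "hit n \<omega> \<longleftrightarrow> (\<exists>k\<in>{1..n}. Z k \<omega> \<ge> c)" for n \<omega>
  have hit_Suc: "hit (Suc n) \<omega> \<longleftrightarrow> hit n \<omega> \<or> Z (Suc n) \<omega> \<ge> c" for n \<omega>
  proof -
    have "{1..Suc n} = insert (Suc n) {1..n}" by auto
    then show ?thesis by (auto simp: hit_def)
  qed
  have hitm: "Measurable.pred (erw_history M \<eta> n) (hit n)" for n
  proof -
    have [measurable]: "Z k \<in> borel_measurable (erw_history M \<eta> n)" if "k \<in> {1..n}" for k
      using that by (intro Zm) auto
    show ?thesis unfolding hit_def by measurable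
  qed
  have [measurable]: "Measurable.pred M (hit n)" for n
    unfolding hit_def by measurable
  \<comment> \<open>After the first passage the process is frozen at \<open>c\<close> itself, not at
    the overshooting value. It still has mean at most \<open>1\<close>, and it dominates
    \<open>c\<close> times the indicator of the passage, without any stopping time.\<close>
  define W where "W n \<omega> = (if hit n \<omega> then c else Z n \<omega>)" for n \<omega>
  have [measurable]: "W n \<in> borel_measurable M" for n
    unfolding W_def by measurable
  have "(\<integral>\<^sup>+\<omega>. ennreal (W n \<omega>) \<partial>M) \<le> 1"
    using n
  proof (induction rule: dec_induct)
    case base
    have "Z 1 \<omega> \<le> 1" for \<omega>
      using erw_var_ge_1[of "2 * p - 1" 1] p01 by (auto simp: Z_def)
    then have "W 1 \<omega> \<le> 1" for \<omega>
      by (auto simp: W_def hit_def intro: order_trans)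
    then have "(\<integral>\<^sup>+\<omega>. ennreal (W 1 \<omega>) \<partial>M) \<le> (\<integral>\<^sup>+\<omega>. 1 \<partial>M)"
      by (intro nn_integral_mono) (auto simp flip: ennreal_1 intro!: ennreal_leI simp del: ennreal_1)
    then show ?case by (simp add: emeasure_space_1)
  next
    case (step n)
    let ?v = "l\<^sup>2 * (erw_scale (2 * p - 1) (Suc n))\<^sup>2 / 2"
    \<comment> \<open>The weight is discounted in advance by the variance factor of the next step,
      which the one-step bound then restores exactly.\<close>
    define Y where "Y \<omega> = ennreal (if hit n \<omega> then 0 else Z n \<omega> * exp (- ?v))" for \<omega>
    have Ym: "Y \<in> borel_measurable (erw_history M \<eta> n)"
    proof -
      note [measurable] = hitm[of n] Zm[OF order_refl, of n]
      show ?thesis unfolding Y_def by measurable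
    qed
    have [measurable]: "Y \<in> borel_measurable M" using Ym by (rule history_measurable_M)
    have [measurable]: "incr (Suc n) \<in> borel_measurable M"
      using incr_measurable[of "Suc n" "Suc n"] by (intro history_measurable_M) auto
    have Z_Suc: "Z (Suc n) \<omega> = Z n \<omega> * exp (- ?v) * exp (l * incr (Suc n) \<omega>)" for \<omega>
      using step by (simp add: Z_def mart_Suc erw_var_Suc algebra_simps
        add_divide_distrib flip: exp_add)
    have "(\<integral>\<^sup>+\<omega>. ennreal (W (Suc n) \<omega>) \<partial>M)
        \<le> (\<integral>\<^sup>+\<omega>. ennreal (if hit n \<omega> then c else 0) + Y \<omega> * ennreal (exp (l * incr (Suc n) \<omega>)) \<partial>M)"
    proof (intro nn_integral_mono)
      fix \<omega>
      have "W (Suc n) \<omega> \<le> (if hit n \<omega> then c else Z (Suc n) \<omega>)"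
        by (auto simp: W_def hit_Suc)
      moreover have "Z n \<omega> \<ge> 0" by (simp add: Z_def)
      ultimately show "ennreal (W (Suc n) \<omega>)
        \<le> ennreal (if hit n \<omega> then c else 0) + Y \<omega> * ennreal (exp (l * incr (Suc n) \<omega>))"
        using c by (auto simp: Y_def Z_Suc intro!: ennreal_leI simp flip: ennreal_mult')
    qed
    also have "\<dots> = (\<integral>\<^sup>+\<omega>. ennreal (if hit n \<omega> then c else 0) \<partial>M)
        + (\<integral>\<^sup>+\<omega>. Y \<omega> * ennreal (exp (l * incr (Suc n) \<omega>)) \<partial>M)"
      by (rule nn_integral_add) measurable
    also have "\<dots> \<le> (\<integral>\<^sup>+\<omega>. ennreal (if hit n \<omega> then c else 0) \<partial>M) + (\<integral>\<^sup>+\<omega>. Y \<omega> * ennreal (exp ?v) \<partial>M)"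
      using step p01 by (intro add_left_mono nn_integral_step_le Ym) auto
    also have "\<dots> = (\<integral>\<^sup>+\<omega>. ennreal (if hit n \<omega> then c else 0) + Y \<omega> * ennreal (exp ?v) \<partial>M)"
      by (rule nn_integral_add[symmetric]) measurable
    also have "\<dots> = (\<integral>\<^sup>+\<omega>. ennreal (W n \<omega>) \<partial>M)"
      by (intro nn_integral_cong)
        (auto simp: W_def Y_def Z_def simp flip: ennreal_mult' exp_add)
    finally show ?case using step.IH by simp
  qed
  moreover have "(\<integral>\<^sup>+\<omega>. ennreal c * indicator {\<omega> \<in> space M. hit n \<omega>} \<omega> \<partial>M) \<le> (\<integral>\<^sup>+\<omega>. ennreal (W n \<omega>) \<partial>M)"
    by (intro nn_integral_mono) (auto simp: W_def indicator_def)
  ultimately have "ennreal c * emeasure M {\<omega> \<in> space M. hit n \<omega>} \<le> 1"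
    by (subst (asm) nn_integral_cmult_indicator) auto
  then have "c * prob {\<omega> \<in> space M. hit n \<omega>} \<le> 1"
    using c by (simp add: emeasure_eq_measure ennreal_mult'[symmetric] flip: ennreal_1)
  then show ?thesis
    using c by (simp add: hit_def field_simps)
qed

text \<open>Exponential bound with the optimal parameter \<open>x / v n\<close>, once for each sign.
  Replacing \<open>v k\<close> by the larger \<open>v n\<close> makes a single parameter serve all
  times up to \<open>n\<close>.\<close>

lemma mart_maximal:
  assumes p01: "0 < p" "p < 1" and n: "n \<ge> 1" and x: "x \<ge> 0"
  shows "prob {\<omega> \<in> space M. \<exists>k\<in>{1..n}. \<bar>mart k \<omega>\<bar> \<ge> x} \<le> 2 * exp (- x\<^sup>2 / (2 * erw_var (2 * p - 1) n))"
proof -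
  define v where "v = erw_var (2 * p - 1)"
  have v: "v n > 0" using erw_var_ge_1[of "2 * p - 1" n] n p01 by (simp add: v_def)
  define E where "E l = {\<omega> \<in> space M. \<exists>k\<in>{1..n}. exp (l * mart k \<omega> - l\<^sup>2 * v k / 2) \<ge> exp (x\<^sup>2 / (2 * v n))}" for l
  have [measurable]: "E l \<in> sets M" for l unfolding E_def by measurable
  have E: "prob (E l) \<le> exp (- x\<^sup>2 / (2 * v n))" for l
    using exp_mart_maximal[OF p01 n, of "exp (x\<^sup>2 / (2 * v n))" l] unfolding E_def v_def
    by (simp add: exp_minus field_simps)
  have key: "exp (l * t - l\<^sup>2 * v k / 2) \<ge> exp (x\<^sup>2 / (2 * v n))"
    if "k \<in> {1..n}" "l * t \<ge> x\<^sup>2 / v n" "l\<^sup>2 = (x / v n)\<^sup>2" for l t k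
  proof -
    have "v k \<le> v n" using that p01 by (simp add: v_def erw_var_mono)
    then have "l\<^sup>2 * v k / 2 \<le> (x / v n)\<^sup>2 * v n / 2"
      unfolding that(3) by (intro divide_right_mono mult_left_mono) auto
    also have "\<dots> = x\<^sup>2 / (2 * v n)" using v by (simp add: power2_eq_square)
    finally show ?thesis using that(2) by simp
  qed
  have "{\<omega> \<in> space M. \<exists>k\<in>{1..n}. \<bar>mart k \<omega>\<bar> \<ge> x} \<subseteq> E (x / v n) \<union> E (- (x / v n))"
  proof (intro subsetI)
    fix \<omega> assume "\<omega> \<in> {\<omega> \<in> space M. \<exists>k\<in>{1..n}. \<bar>mart k \<omega>\<bar> \<ge> x}"
    then obtain k where k: "\<omega> \<in> space M" "k \<in> {1..n}" "\<bar>mart k \<omega>\<bar> \<ge> x" by auto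
    have "x * \<bar>mart k \<omega>\<bar> \<ge> x * x" using k x by (intro mult_left_mono) auto
    then have "x / v n * \<bar>mart k \<omega>\<bar> \<ge> x\<^sup>2 / v n"
      using v by (simp add: power2_eq_square divide_right_mono)
    then show "\<omega> \<in> E (x / v n) \<union> E (- (x / v n))"
      using key[OF k(2), of "x / v n" "mart k \<omega>"] key[OF k(2), of "- (x / v n)" "mart k \<omega>"] k
      unfolding E_def by (cases "mart k \<omega> \<ge> 0") fastforce+
  qed
  then have "prob {\<omega> \<in> space M. \<exists>k\<in>{1..n}. \<bar>mart k \<omega>\<bar> \<ge> x} \<le> prob (E (x / v n) \<union> E (- (x / v n)))"
    by (intro finite_measure_mono) auto
  also have "\<dots> \<le> prob (E (x / v n)) + prob (E (- (x / v n)))"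
    by (intro measure_Un_le) auto
  also have "\<dots> \<le> exp (- x\<^sup>2 / (2 * v n)) + exp (- x\<^sup>2 / (2 * v n))"
    by (intro add_mono E)
  finally show ?thesis by (simp add: v_def)
qed

section \<open>Exponential moments and tails of blocks\<close>

lemma block_Suc:
  assumes "m \<le> n"
  shows "good_sum r m (Suc n) \<omega> = good_sum r m n \<omega> + (if \<bar>drift n \<omega>\<bar> \<le> r then incr (Suc n) \<omega> else 0)"
    and "bad_var r m (Suc n) \<omega> = bad_var r m n \<omega>
      + (if \<bar>drift n \<omega>\<bar> \<le> r then 0 else (erw_scale (2 * p - 1) (Suc n))\<^sup>2)"
proof -
  have "{m<..Suc n} = insert (Suc n) {m<..n}" using assms by auto
  then show "good_sum r m (Suc n) \<omega> = good_sum r m n \<omega> + (if \<bar>drift n \<omega>\<bar> \<le> r then incr (Suc n) \<omega> else 0)"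
    "bad_var r m (Suc n) \<omega> = bad_var r m n \<omega>
      + (if \<bar>drift n \<omega>\<bar> \<le> r then 0 else (erw_scale (2 * p - 1) (Suc n))\<^sup>2)"
    by (simp_all add: good_sum_def bad_var_def)
qed

text \<open>
  When the drift exceeds \<open>r\<close>, the conditional variance of the step may be far from \<open>1\<close>. Such a step is
  replaced by a deterministic contribution to the exponent, so that both exponential bounds below
  hold conditionally on the past, without any exceptional event.
\<close>

definition block_exp :: "real \<Rightarrow> real \<Rightarrow> real \<Rightarrow> nat \<Rightarrow> nat \<Rightarrow> 'a \<Rightarrow> real" where
  "block_exp e l r m n \<omega> = exp (l * good_sum r m n \<omega> + (1 - e) * l\<^sup>2 * bad_var r m n \<omega> / 2)"

lemma block_exp_nonneg: "block_exp e l r m n \<omega> \<ge> 0"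
  by (simp add: block_exp_def)

lemma block_exp_measurable:
  assumes "1 \<le> m"
  shows "block_exp e l r m n \<in> borel_measurable (erw_history M \<eta> n)"
proof -
  note [measurable] = block_measurable[OF assms]
  show ?thesis unfolding block_exp_def by measurable
qed

lemma block_exp_Suc:
  assumes "m \<le> n"
  shows "block_exp e l r m (Suc n) \<omega> =
    (if \<bar>drift n \<omega>\<bar> \<le> r then block_exp e l r m n \<omega> * exp (l * incr (Suc n) \<omega>)
     else block_exp e l r m n \<omega> * exp ((1 - e) * l\<^sup>2 * (erw_scale (2 * p - 1) (Suc n))\<^sup>2 / 2))"
  by (simp add: block_exp_def block_Suc[OF assms] algebra_simps add_divide_distrib diff_divide_distrib flip: exp_add)

text \<open>Common induction step of both exponential bounds. On the part \<open>Y'\<close> of large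
  drift the new factor is deterministic, so only \<open>Y\<close> needs an estimate; the last
  equation provides the comparison with a factor \<open>c\<close> on both parts.\<close>

lemma block_exp_split:
  fixes e l r c :: real
  assumes m: "1 \<le> m" "m \<le> n" and G: "G \<in> sets (erw_history M \<eta> m)"
  defines "Y \<equiv> \<lambda>\<omega>. ennreal (block_exp e l r m n \<omega>) * indicator G \<omega> * indicator {\<omega>. \<bar>drift n \<omega>\<bar> \<le> r} \<omega>"
    and "Y' \<equiv> \<lambda>\<omega>. ennreal (block_exp e l r m n \<omega>) * indicator G \<omega> * indicator {\<omega>. \<not> \<bar>drift n \<omega>\<bar> \<le> r} \<omega>"
  shows "Y \<in> borel_measurable (erw_history M \<eta> n)"
    and "(\<integral>\<^sup>+\<omega>. ennreal (block_exp e l r m (Suc n) \<omega>) * indicator G \<omega> \<partial>M)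
      = (\<integral>\<^sup>+\<omega>. Y \<omega> * ennreal (exp (l * incr (Suc n) \<omega>)) \<partial>M)
        + (\<integral>\<^sup>+\<omega>. Y' \<omega> * ennreal (exp ((1 - e) * l\<^sup>2 * (erw_scale (2 * p - 1) (Suc n))\<^sup>2 / 2)) \<partial>M)"
    and "(\<integral>\<^sup>+\<omega>. ennreal (block_exp e l r m n \<omega>) * indicator G \<omega> \<partial>M) * ennreal c
      = (\<integral>\<^sup>+\<omega>. Y \<omega> * ennreal c \<partial>M) + (\<integral>\<^sup>+\<omega>. Y' \<omega> * ennreal c \<partial>M)"
proof -
  note [measurable] = block_exp_measurable[OF m(1)] drift_measurable[OF order_refl]
  have [measurable]: "G \<in> sets (erw_history M \<eta> n)"
    using G sets_history_mono[OF m(2)] by auto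
  have [measurable]: "G \<in> sets M" using G by (rule sets_history)
  have [measurable]: "incr (Suc n) \<in> borel_measurable M"
    using incr_measurable[of "Suc n" "Suc n"] by (intro history_measurable_M) auto
  show Ym: "Y \<in> borel_measurable (erw_history M \<eta> n)"
    unfolding Y_def indicator_def by measurable
  have [measurable]: "Y' \<in> borel_measurable (erw_history M \<eta> n)"
    unfolding Y'_def indicator_def by measurable
  have [measurable]: "Y \<in> borel_measurable M" "Y' \<in> borel_measurable M"
    "block_exp e l r m n \<in> borel_measurable M"
    using Ym by (auto intro!: history_measurable_M[of _ n])
  show "(\<integral>\<^sup>+\<omega>. ennreal (block_exp e l r m (Suc n) \<omega>) * indicator G \<omega> \<partial>M)
      = (\<integral>\<^sup>+\<omega>. Y \<omega> * ennreal (exp (l * incr (Suc n) \<omega>)) \<partial>M)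
        + (\<integral>\<^sup>+\<omega>. Y' \<omega> * ennreal (exp ((1 - e) * l\<^sup>2 * (erw_scale (2 * p - 1) (Suc n))\<^sup>2 / 2)) \<partial>M)"
  proof (subst nn_integral_add[symmetric])
    show "(\<integral>\<^sup>+\<omega>. ennreal (block_exp e l r m (Suc n) \<omega>) * indicator G \<omega> \<partial>M)
      = (\<integral>\<^sup>+\<omega>. Y \<omega> * ennreal (exp (l * incr (Suc n) \<omega>))
        + Y' \<omega> * ennreal (exp ((1 - e) * l\<^sup>2 * (erw_scale (2 * p - 1) (Suc n))\<^sup>2 / 2)) \<partial>M)"
      by (intro nn_integral_cong)
        (auto simp: block_exp_Suc[OF m(2)] Y_def Y'_def indicator_def ennreal_mult'')
  qed measurable
  show "(\<integral>\<^sup>+\<omega>. ennreal (block_exp e l r m n \<omega>) * indicator G \<omega> \<partial>M) * ennreal c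
      = (\<integral>\<^sup>+\<omega>. Y \<omega> * ennreal c \<partial>M) + (\<integral>\<^sup>+\<omega>. Y' \<omega> * ennreal c \<partial>M)"
  proof (subst nn_integral_add[symmetric])
    show "(\<integral>\<^sup>+\<omega>. ennreal (block_exp e l r m n \<omega>) * indicator G \<omega> \<partial>M) * ennreal c
      = (\<integral>\<^sup>+\<omega>. Y \<omega> * ennreal c + Y' \<omega> * ennreal c \<partial>M)"
      by (subst nn_integral_multc[symmetric])
        (auto intro!: nn_integral_cong simp: Y_def Y'_def indicator_def)
  qed measurable
qed

text \<open>Testing against every \<open>G\<close> of the history at \<open>m\<close> expresses the
  bound conditionally on that history. Good steps use Hoeffding; bad steps contribute the claimed
  factor with equality.\<close>

lemma block_exp_le:
  assumes p01: "0 < p" "p < 1" and m: "1 \<le> m" "m \<le> n" and G: "G \<in> sets (erw_history M \<eta> m)"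
  shows "(\<integral>\<^sup>+\<omega>. ennreal (block_exp 0 l r m n \<omega>) * indicator G \<omega> \<partial>M)
    \<le> ennreal (exp (l\<^sup>2 * (erw_var (2 * p - 1) n - erw_var (2 * p - 1) m) / 2)) * emeasure M G"
  using m(2)
proof (induction rule: dec_induct)
  case base
  have "(\<integral>\<^sup>+\<omega>. ennreal (block_exp 0 l r m m \<omega>) * indicator G \<omega> \<partial>M) = (\<integral>\<^sup>+\<omega>. indicator G \<omega> \<partial>M)"
    by (simp add: block_exp_def good_sum_def bad_var_def)
  then show ?case using sets_history[OF G] by simp
next
  case (step n)
  let ?v = "l\<^sup>2 * (erw_scale (2 * p - 1) (Suc n))\<^sup>2 / 2"
  note split = block_exp_split[OF m(1) \<open>m \<le> n\<close> G, of 0 l r]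
  have "(\<integral>\<^sup>+\<omega>. ennreal (block_exp 0 l r m (Suc n) \<omega>) * indicator G \<omega> \<partial>M)
    \<le> (\<integral>\<^sup>+\<omega>. ennreal (block_exp 0 l r m n \<omega>) * indicator G \<omega> \<partial>M) * ennreal (exp ?v)"
    unfolding split(2,3) using p01 m step
    by (intro add_mono order_trans[OF nn_integral_step_le[OF _ _ _ split(1)]]) auto
  also have "\<dots> \<le> ennreal (exp (l\<^sup>2 * (erw_var (2 * p - 1) n - erw_var (2 * p - 1) m) / 2))
      * emeasure M G * ennreal (exp ?v)"
    by (intro mult_right_mono step.IH) auto
  also have "\<dots> = ennreal (exp (l\<^sup>2 * (erw_var (2 * p - 1) (Suc n) - erw_var (2 * p - 1) m) / 2)) * emeasure M G"
  proof -
    have "exp (l\<^sup>2 * (erw_var (2 * p - 1) (Suc n) - erw_var (2 * p - 1) m) / 2)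
      = exp (l\<^sup>2 * (erw_var (2 * p - 1) n - erw_var (2 * p - 1) m) / 2) * exp ?v"
      using p01 by (simp add: erw_var_Suc algebra_simps add_divide_distrib diff_divide_distrib flip: exp_add)
    then show ?thesis by (simp add: ennreal_mult mult_ac)
  qed
  finally show ?case .
qed

text \<open>The discount \<open>1 - e\<close> in the compensator matches the loss on good steps, so
  bad steps again give equality.\<close>

lemma block_exp_ge:
  assumes p01: "0 < p" "p < 1" and m: "1 \<le> m" "m \<le> n" and G: "G \<in> sets (erw_history M \<eta> m)"
    and e: "0 \<le> e" "e \<le> 1" "r\<^sup>2 \<le> e / 2" "l \<ge> 0"
    and small: "\<And>k. k \<in> {m<..n} \<Longrightarrow> l * erw_scale (2 * p - 1) k \<le> e / 8"
  shows "ennreal (exp ((1 - e) * l\<^sup>2 * (erw_var (2 * p - 1) n - erw_var (2 * p - 1) m) / 2)) * emeasure M G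
    \<le> (\<integral>\<^sup>+\<omega>. ennreal (block_exp e l r m n \<omega>) * indicator G \<omega> \<partial>M)"
  using m(2) small
proof (induction rule: dec_induct)
  case base
  have "(\<integral>\<^sup>+\<omega>. ennreal (block_exp e l r m m \<omega>) * indicator G \<omega> \<partial>M) = (\<integral>\<^sup>+\<omega>. indicator G \<omega> \<partial>M)"
    by (simp add: block_exp_def good_sum_def bad_var_def)
  then show ?case using sets_history[OF G] by simp
next
  case (step n)
  let ?v = "(1 - e) * l\<^sup>2 * (erw_scale (2 * p - 1) (Suc n))\<^sup>2 / 2"
  note split = block_exp_split[OF m(1) \<open>m \<le> n\<close> G, of e l r]
  have IH: "ennreal (exp ((1 - e) * l\<^sup>2 * (erw_var (2 * p - 1) n - erw_var (2 * p - 1) m) / 2)) * emeasure M G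
    \<le> (\<integral>\<^sup>+\<omega>. ennreal (block_exp e l r m n \<omega>) * indicator G \<omega> \<partial>M)"
    using step.prems by (intro step.IH) auto
  have "ennreal (exp ((1 - e) * l\<^sup>2 * (erw_var (2 * p - 1) (Suc n) - erw_var (2 * p - 1) m) / 2)) * emeasure M G
    = ennreal (exp ((1 - e) * l\<^sup>2 * (erw_var (2 * p - 1) n - erw_var (2 * p - 1) m) / 2))
      * emeasure M G * ennreal (exp ?v)"
  proof -
    have "exp ((1 - e) * l\<^sup>2 * (erw_var (2 * p - 1) (Suc n) - erw_var (2 * p - 1) m) / 2)
      = exp ((1 - e) * l\<^sup>2 * (erw_var (2 * p - 1) n - erw_var (2 * p - 1) m) / 2) * exp ?v"
      using p01 by (simp add: erw_var_Suc algebra_simps add_divide_distrib diff_divide_distrib flip: exp_add)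
    then show ?thesis by (simp add: ennreal_mult mult_ac)
  qed
  also have "\<dots> \<le> (\<integral>\<^sup>+\<omega>. ennreal (block_exp e l r m n \<omega>) * indicator G \<omega> \<partial>M) * ennreal (exp ?v)"
    by (intro mult_right_mono IH) auto
  also have "\<dots> \<le> (\<integral>\<^sup>+\<omega>. ennreal (block_exp e l r m (Suc n) \<omega>) * indicator G \<omega> \<partial>M)"
    unfolding split(2,3)
  proof (intro add_mono order_refl nn_integral_step_ge[OF _ _ _ split(1), where r = r])
    show "0 \<le> l * erw_scale (2 * p - 1) (Suc n)"
      using e erw_scale_pos[of "2 * p - 1" "Suc n"] p01 by simp
    show "l * erw_scale (2 * p - 1) (Suc n) \<le> e / 8"
      using step by auto
  qed (use p01 m step e in \<open>auto simp: indicator_def split: if_splits\<close>)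
  finally show ?case .
qed

text \<open>
  Cramer-type lower bound: under the exponential tilt with parameter \<open>l\<close>, the sum concentrates around
  \<open>l * W\<close>. The mass below \<open>(1 - d) * l * W\<close> and the mass where the exponent exceeds
  \<open>(1 + d) * l\<^sup>2 * W\<close> are controlled by the upper bound at \<open>(1 - d) * l\<close> and \<open>(1 + d) * l\<close>.
\<close>

lemma block_tail:
  fixes l d W r :: real and m n :: nat
  assumes p01: "0 < p" "p < 1" and m: "1 \<le> m" "m \<le> n" and G: "G \<in> sets (erw_history M \<eta> m)"
    and d: "0 < d" "d < 1" "r\<^sup>2 \<le> d\<^sup>2 / 4" "l \<ge> 0"
    and small: "\<And>k. k \<in> {m<..n} \<Longrightarrow> l * erw_scale (2 * p - 1) k \<le> d\<^sup>2 / 16"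
    and W_def: "W = erw_var (2 * p - 1) n - erw_var (2 * p - 1) m"
    and L_def: "L = l\<^sup>2 * W / 2" and L: "exp (- L * d\<^sup>2 / 2) \<le> 1 / 4"
  shows "prob G * (exp (- L * (1 + d)\<^sup>2) / 2)
    \<le> prob (G \<inter> {\<omega> \<in> space M. good_sum r m n \<omega> \<ge> (1 - d) * l * W \<or> bad_var r m n \<omega> > 0})"
proof -
  define B where "B = {\<omega> \<in> space M. good_sum r m n \<omega> \<ge> (1 - d) * l * W \<or> bad_var r m n \<omega> > 0}"
  \<comment> \<open>Both error masses will be at most \<open>exp (L * (1 - d^2)) * prob G\<close>.
    The total is at least \<open>exp ((1 - e) * L) * prob G\<close>, so this \<open>e\<close> leaves
    a gap of \<open>exp (- L * d^2 / 2)\<close>, at most \<open>1 / 4\<close>, and the errors use up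
    no more than half of the total.\<close>
  define e where "e = d\<^sup>2 / 2"
  have d2: "d\<^sup>2 \<le> 1" using d by (simp add: power_le_one)
  have e: "0 \<le> e" "e \<le> 1" "r\<^sup>2 \<le> e / 2" using d d2 by (auto simp: e_def)
  note [measurable] = block_measurable[OF m(1)] block_exp_measurable[OF m(1)] sets_history[OF G]
  have [measurable]: "good_sum r m n \<in> borel_measurable M" "bad_var r m n \<in> borel_measurable M"
      "block_exp e' l' r m n \<in> borel_measurable M" for e' l'
    by (rule history_measurable_M[of _ n]; measurable)+
  have [measurable]: "B \<in> sets M" unfolding B_def by measurable
  define U where "U l = (\<integral>\<^sup>+\<omega>. ennreal (block_exp 0 l r m n \<omega>) * indicator G \<omega> \<partial>M)" for l
  have U: "U (c * l) \<le> ennreal (exp (c\<^sup>2 * L) * prob G)" for c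
    using block_exp_le[OF p01 m G, of "c * l" r]
    by (simp add: U_def L_def W_def power_mult_distrib emeasure_eq_measure ennreal_mult mult_ac)
  have bad_nonneg: "bad_var r m n \<omega> \<ge> 0" for \<omega>
    unfolding bad_var_def by (intro sum_nonneg) auto
  have "ennreal (exp ((1 - e) * L) * prob G) \<le> (\<integral>\<^sup>+\<omega>. ennreal (block_exp e l r m n \<omega>) * indicator G \<omega> \<partial>M)"
    using block_exp_ge[OF p01 m G e \<open>l \<ge> 0\<close>] small
    by (simp add: e_def L_def W_def emeasure_eq_measure ennreal_mult mult_ac)
  also have "\<dots> \<le> (\<integral>\<^sup>+\<omega>. ennreal (exp (2 * L * (1 + d))) * indicator (G \<inter> B) \<omega>
      + (ennreal (exp (2 * L * d * (1 - d))) * (ennreal (block_exp 0 ((1 - d) * l) r m n \<omega>) * indicator G \<omega>)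
      + ennreal (exp (- (2 * L * d * (1 + d)))) * (ennreal (block_exp 0 ((1 + d) * l) r m n \<omega>) * indicator G \<omega>)) \<partial>M)"
  proof (intro nn_integral_mono)
    fix \<omega> assume \<omega>: "\<omega> \<in> space M"
    define T R where "T = good_sum r m n \<omega>" and "R = bad_var r m n \<omega>"
    have R: "R \<ge> 0" using bad_nonneg by (simp add: R_def)
    define Q where "Q = l * T + (1 - e) * l\<^sup>2 * R / 2"
    have Q: "block_exp e l r m n \<omega> = exp Q" by (simp add: Q_def T_def R_def block_exp_def)
    consider "\<omega> \<notin> G" | "\<omega> \<in> G" "\<omega> \<notin> B" | "\<omega> \<in> G" "Q > 2 * L * (1 + d)"
      | "\<omega> \<in> G" "\<omega> \<in> B" "Q \<le> 2 * L * (1 + d)" by linarith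
    then have "exp Q * indicator G \<omega> \<le> exp (2 * L * (1 + d)) * indicator (G \<inter> B) \<omega>
      + (exp (2 * L * d * (1 - d)) * (block_exp 0 ((1 - d) * l) r m n \<omega> * indicator G \<omega>)
      + exp (- (2 * L * d * (1 + d))) * (block_exp 0 ((1 + d) * l) r m n \<omega> * indicator G \<omega>))"
    proof cases
      case 2
      then have T: "T \<le> (1 - d) * l * W" "R = 0"
        using \<omega> R by (auto simp: B_def T_def R_def)
      have "d * l * T \<le> d * l * ((1 - d) * l * W)"
        using T d by (intro mult_left_mono) auto
      then have "Q \<le> 2 * L * d * (1 - d) + (1 - d) * l * T"
        unfolding Q_def L_def T(2) by (simp add: power2_eq_square algebra_simps)
      then have "exp Q \<le> exp (2 * L * d * (1 - d)) * block_exp 0 ((1 - d) * l) r m n \<omega>"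
        using T(2) by (simp add: block_exp_def T_def R_def flip: exp_add)
      then show ?thesis using 2 by (simp add: block_exp_def add_increasing2)
    next
      \<comment> \<open>Chernoff: since \<open>Q\<close> exceeds \<open>2 * L * (1 + d)\<close>, it
        is at most \<open>(1 + d) * Q - 2 * L * d * (1 + d)\<close>. The compensator grows by less
        than under the parameter \<open>(1 + d) * l\<close>, so rejected steps are harmless
        here.\<close>
      case 3
      have "d * (2 * L * (1 + d)) \<le> d * Q" using 3 d by (intro mult_left_mono) auto
      moreover have "(1 + d) * (1 - e) * (l\<^sup>2 * R / 2) \<le> (1 + d)\<^sup>2 * (l\<^sup>2 * R / 2)"
        using e d R by (intro mult_right_mono) (auto simp: power2_eq_square)
      moreover have "Q + d * Q = (1 + d) * l * T + (1 + d) * (1 - e) * (l\<^sup>2 * R / 2)"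
        by (simp add: Q_def field_simps)
      moreover have "((1 + d) * l)\<^sup>2 * R / 2 = (1 + d)\<^sup>2 * (l\<^sup>2 * R / 2)"
        by (simp add: power_mult_distrib)
      moreover have "d * (2 * L * (1 + d)) = 2 * L * d * (1 + d)" by simp
      ultimately have "Q \<le> - (2 * L * d * (1 + d)) + ((1 + d) * l * T + ((1 + d) * l)\<^sup>2 * R / 2)"
        by linarith
      then have "exp Q \<le> exp (- (2 * L * d * (1 + d))) * block_exp 0 ((1 + d) * l) r m n \<omega>"
        by (simp add: block_exp_def T_def R_def flip: exp_add)
      then show ?thesis using 3 by (simp add: block_exp_def add_increasing)
    qed (auto simp: block_exp_def intro!: add_nonneg_nonneg add_increasing2)
    then show "ennreal (block_exp e l r m n \<omega>) * indicator G \<omega>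
      \<le> ennreal (exp (2 * L * (1 + d))) * indicator (G \<inter> B) \<omega>
      + (ennreal (exp (2 * L * d * (1 - d))) * (ennreal (block_exp 0 ((1 - d) * l) r m n \<omega>) * indicator G \<omega>)
      + ennreal (exp (- (2 * L * d * (1 + d)))) * (ennreal (block_exp 0 ((1 + d) * l) r m n \<omega>) * indicator G \<omega>))"
      by (auto simp: Q block_exp_nonneg indicator_def simp flip: ennreal_mult'' ennreal_plus intro!: ennreal_leI)
  qed
  also have "\<dots> = ennreal (exp (2 * L * (1 + d))) * emeasure M (G \<inter> B)
      + (ennreal (exp (2 * L * d * (1 - d))) * U ((1 - d) * l)
      + ennreal (exp (- (2 * L * d * (1 + d)))) * U ((1 + d) * l))"
    unfolding U_def
    by (simp add: nn_integral_add nn_integral_cmult nn_integral_cmult_indicator)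
  also have "\<dots> \<le> ennreal (exp (2 * L * (1 + d))) * ennreal (prob (G \<inter> B))
      + (ennreal (exp (2 * L * d * (1 - d))) * ennreal (exp ((1 - d)\<^sup>2 * L) * prob G)
      + ennreal (exp (- (2 * L * d * (1 + d)))) * ennreal (exp ((1 + d)\<^sup>2 * L) * prob G))"
    unfolding emeasure_eq_measure by (intro add_mono mult_left_mono U order_refl) auto
  also have "\<dots> = ennreal (exp (2 * L * (1 + d)) * prob (G \<inter> B) + 2 * (exp (L * (1 - d\<^sup>2)) * prob G))"
  proof -
    have eq: "exp (2 * L * d * (1 - d)) * (exp ((1 - d)\<^sup>2 * L) * prob G) = exp (L * (1 - d\<^sup>2)) * prob G"
      "exp (- (2 * L * d * (1 + d))) * (exp ((1 + d)\<^sup>2 * L) * prob G) = exp (L * (1 - d\<^sup>2)) * prob G"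
      by (simp_all add: power2_eq_square algebra_simps flip: exp_add)
    show ?thesis
      by (simp only: ennreal_mult[symmetric] ennreal_plus[symmetric] exp_ge_zero measure_nonneg
        mult_nonneg_nonneg add_nonneg_nonneg eq
        mult_2[of "exp (L * (1 - d\<^sup>2)) * prob G"])
  qed
  finally have *: "exp ((1 - e) * L) * prob G
      \<le> exp (2 * L * (1 + d)) * prob (G \<inter> B) + 2 * (exp (L * (1 - d\<^sup>2)) * prob G)"
    by (subst (asm) ennreal_le_iff) auto
  have "exp (L * (1 - d\<^sup>2)) = exp ((1 - e) * L) * exp (- L * d\<^sup>2 / 2)"
    by (simp add: e_def field_simps flip: exp_add)
  also have "\<dots> \<le> exp ((1 - e) * L) * (1 / 4)" using L by (intro mult_left_mono) auto
  finally have "exp (L * (1 - d\<^sup>2)) * prob G \<le> exp ((1 - e) * L) * (1 / 4) * prob G"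
    by (intro mult_right_mono) auto
  with * have "exp ((1 - e) * L) * prob G / 2 \<le> exp (2 * L * (1 + d)) * prob (G \<inter> B)"
    by simp
  from mult_left_mono[OF this, of "exp (- (2 * L * (1 + d)))"]
  have "exp (- (2 * L * (1 + d))) * (exp ((1 - e) * L) * prob G / 2) \<le> prob (G \<inter> B)"
    by (simp add: mult.assoc[symmetric] flip: exp_add)
  \<comment> \<open>The exponent is \<open>- L * (1 + 2 * d + d^2 / 2)\<close>; completing the
    square only lowers it.\<close>
  moreover have "exp (- L * (1 + d)\<^sup>2) \<le> exp (- (2 * L * (1 + d))) * exp ((1 - e) * L)"
  proof -
    have "L \<ge> 0" using p01 m by (simp add: L_def W_def erw_var_mono)
    then have "L * (d\<^sup>2 / 2) \<ge> 0" by simp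
    then show ?thesis
      by (simp add: e_def power2_eq_square algebra_simps flip: exp_add)
  qed
  then have "exp (- L * (1 + d)\<^sup>2) * (prob G / 2) \<le> exp (- (2 * L * (1 + d))) * exp ((1 - e) * L) * (prob G / 2)"
    by (intro mult_right_mono) auto
  ultimately show ?thesis by (simp add: B_def mult_ac)
qed

end

subsection \<open>The law of the iterated logarithm\<close>

text \<open>The lower bound \<open>c j\<close> on the conditional probability replaces independence:
  avoiding one more \<open>B j\<close> multiplies the probability by at most \<open>1 - c j\<close>,
  hence by at most \<open>exp (- c j)\<close>, and the exponents diverge.\<close>

lemma (in prob_space) conditional_borel_cantelli:
  fixes F :: "nat \<Rightarrow> 'a set set" and B :: "nat \<Rightarrow> 'a set" and c :: "nat \<Rightarrow> real"
  assumes events: "\<And>j. F j \<subseteq> sets M" "\<And>j. space M \<in> F j"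
    and F_Suc: "\<And>j G. J \<le> j \<Longrightarrow> G \<in> F j \<Longrightarrow> G - B j \<in> F (Suc j)"
    and B: "\<And>j. B j \<in> sets M"
    and cond: "\<And>j G. J \<le> j \<Longrightarrow> G \<in> F j \<Longrightarrow> c j * prob G \<le> prob (G \<inter> B j)"
    and c: "\<And>j. c j \<ge> 0" "\<not> summable c"
  shows "AE \<omega> in M. \<exists>\<^sub>F j in sequentially. \<omega> \<in> B j"
proof -
  have "AE \<omega> in M. \<exists>j\<ge>K. \<omega> \<in> B j" if K: "K \<ge> J" for K
  proof -
    define G where "G n = space M - (\<Union>j\<in>{K..<K + n}. B j)" for n
    have G_Suc: "G (Suc n) = G n - B (K + n)" for n
      by (auto simp: G_def less_Suc_eq)
    have GF: "G n \<in> F (K + n)" for n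
    proof (induction n)
      case 0
      then show ?case using events(2) by (simp add: G_def)
    next
      case (Suc n)
      then show ?case using F_Suc[OF _ Suc] K by (simp add: G_Suc)
    qed
    have [measurable]: "G n \<in> sets M" for n using GF events(1) by blast
    have bound: "prob (G n) \<le> exp (- (\<Sum>j<n. c (K + j)))" for n
    proof (induction n)
      case (Suc n)
      have "prob (G n) = prob (G n \<inter> B (K + n)) + prob (G (Suc n))"
        unfolding G_Suc using B by (subst finite_measure_Union[symmetric]) (auto intro!: arg_cong[where f = prob])
      then have "prob (G (Suc n)) \<le> (1 - c (K + n)) * prob (G n)"
        using cond[OF _ GF[of n]] K by (simp add: algebra_simps)
      also have "\<dots> \<le> exp (- c (K + n)) * prob (G n)"
        using exp_ge_add_one_self[of "- c (K + n)"] by (intro mult_right_mono) auto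
      also have "\<dots> \<le> exp (- c (K + n)) * exp (- (\<Sum>j<n. c (K + j)))"
        using Suc by (intro mult_left_mono) auto
      finally show ?case by (simp add: algebra_simps flip: exp_add)
    qed simp
    have "\<not> summable (\<lambda>j. c (K + j))"
      using c(2) by (simp add: add.commute summable_iff_shift)
    have "prob (\<Inter>n. G n) \<le> 0"
    proof (rule ccontr)
      assume "\<not> prob (\<Inter>n. G n) \<le> 0"
      moreover have "prob (\<Inter>n. G n) \<le> exp (- (\<Sum>j<n. c (K + j)))" for n
        by (rule order_trans[OF finite_measure_mono bound]) auto
      ultimately have "(\<Sum>j<n. c (K + j)) \<le> - ln (prob (\<Inter>n. G n))" for n
        by (smt (verit) ln_exp ln_le_cancel_iff exp_gt_zero)
      then have "summable (\<lambda>j. c (K + j))"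
        using c(1) by (intro summableI_nonneg_bounded) auto
      then show False using \<open>\<not> summable (\<lambda>j. c (K + j))\<close> by blast
    qed
    then have "(\<Inter>n. G n) \<in> null_sets M"
      by (auto simp: null_sets_def emeasure_eq_measure measure_le_0_iff)
    moreover have "{\<omega> \<in> space M. \<not> (\<exists>j\<ge>K. \<omega> \<in> B j)} \<subseteq> (\<Inter>n. G n)"
      by (auto simp: G_def)
    ultimately show ?thesis by (rule AE_I')
  qed
  then have "AE \<omega> in M. \<forall>K. \<exists>j\<ge>J + K. \<omega> \<in> B j"
    by (subst AE_all_countable) auto
  then show ?thesis
    by eventually_elim (auto simp: frequently_sequentially, meson le_add2 order_trans)
qed

context elephant_random_walk
begin

abbreviation (input) "scl \<equiv> erw_scale (2 * p - 1)"
abbreviation (input) "V \<equiv> erw_var (2 * p - 1)"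

text \<open>One \<open>b\<close> plays two roles: replacing \<open>V\<close> by the end of its
  geometric interval costs a factor \<open>b\<close>, the threshold gains \<open>b^2\<close>. The
  net exponent \<open>b\<close> above \<open>1\<close> makes the probabilities summable.\<close>

lemma mart_upper:
  assumes p01: "0 < p" "p < 1" and V_top: "filterlim (erw_var (2 * p - 1)) at_top sequentially"
    and b: "b > 1"
  shows "AE \<omega> in M. \<forall>\<^sub>F n in sequentially. \<bar>mart n \<omega>\<bar> \<le> b * lil_norm (V n)"
proof -
  \<comment> \<open>The last time in the interval: the index just before \<open>V\<close> first
    exceeds \<open>b ^ Suc j\<close>. It exists because \<open>V 0 = 0\<close>.\<close>
  have "\<exists>N. V N \<le> b ^ Suc j \<and> (\<forall>k. V k \<le> b ^ Suc j \<longrightarrow> k \<le> N)" for j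
  proof -
    define m where "m = (LEAST n. b ^ Suc j < V n)"
    have "eventually (\<lambda>n. b ^ Suc j < V n) sequentially"
      using V_top by (auto simp: filterlim_at_top_dense)
    then obtain n0 where "b ^ Suc j < V n0" by (auto simp: eventually_sequentially)
    then have m: "b ^ Suc j < V m" unfolding m_def by (rule LeastI)
    have "V 0 \<le> b ^ Suc j" using b by (simp add: erw_var_def)
    then obtain N where N: "m = Suc N" using m by (cases m) auto
    have "\<not> b ^ Suc j < V N"
      using not_less_Least[of N "\<lambda>n. b ^ Suc j < V n"] N by (simp add: m_def)
    moreover have "k \<le> N" if "V k \<le> b ^ Suc j" for k
    proof (rule ccontr)
      assume "\<not> k \<le> N"
      then have "V m \<le> V k" using N by (intro erw_var_mono) auto
      then show False using m that by simp
    qed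
    ultimately show ?thesis by (intro exI[of _ N]) auto
  qed
  then obtain N where N: "\<And>j. V (N j) \<le> b ^ Suc j" "\<And>j k. V k \<le> b ^ Suc j \<Longrightarrow> k \<le> N j"
    by metis
  have V1: "V 1 = 1" using erw_scale_1[of "2 * p - 1"] p01 by (simp add: erw_var_def)
  have N1: "N j \<ge> 1" for j
    using V1 b by (intro N(2)) (simp del: power_Suc add: one_le_power)
  define E where "E j = {\<omega> \<in> space M. \<exists>k\<in>{1..N j}. \<bar>mart k \<omega>\<bar> \<ge> b * lil_norm (b ^ j)}" for j
  have [measurable]: "E j \<in> sets M" for j unfolding E_def by measurable
  have lnb: "ln b > 0" using b by simp
  have "eventually (\<lambda>j. b ^ j \<ge> exp 1) sequentially"
    using power_at_top[OF b] by (auto simp: filterlim_at_top)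
  then obtain J where J: "\<And>j. j \<ge> J \<Longrightarrow> b ^ j \<ge> exp 1"
    by (auto simp: eventually_sequentially)
  have prob_E: "prob (E j) \<le> 2 * ln b powr (- b) * real j powr (- b)" if j: "j \<ge> J" for j
  proof -
    define x where "x = b * lil_norm (b ^ j)"
    have lnln: "ln (ln (b ^ j)) \<ge> 0" using lnln_mono(1)[OF J[OF j] order_refl] .
    then have x: "x \<ge> 0" "x\<^sup>2 = b\<^sup>2 * (2 * b ^ j * ln (ln (b ^ j)))"
      using b by (auto simp: x_def lil_norm_def power_mult_distrib)
    have "prob (E j) \<le> 2 * exp (- x\<^sup>2 / (2 * V (N j)))"
      unfolding E_def x_def[symmetric] using p01 N1 x by (intro mart_maximal) auto
    also have "\<dots> \<le> 2 * exp (- x\<^sup>2 / (2 * b ^ Suc j))"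
      using N(1)[of j] erw_var_ge_1[of "2 * p - 1" "N j"] N1[of j] p01 b
      by (auto intro!: divide_left_mono simp del: power_Suc)
    also have "- x\<^sup>2 / (2 * b ^ Suc j) = - b * ln (ln (b ^ j))"
      using b by (simp add: x(2)) (simp add: power2_eq_square)
    also have "ln (b ^ j) = real j * ln b" using b by (simp add: ln_realpow)
    also have "exp (- b * ln (real j * ln b)) = ln b powr (- b) * real j powr (- b)"
    \<comment> \<open>For \<open>j = 0\<close> the choice of \<open>J\<close> would give
      \<open>exp 1\<close> at most \<open>1\<close>.\<close>
    proof (cases "j = 0")
      case True
      have "exp 1 > (1 :: real)" by simp
      then show ?thesis using J[OF j] True by simp
    next
      case False
      then have "exp (- b * ln (real j * ln b)) = (real j * ln b) powr (- b)"
        using lnb by (simp add: powr_def)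
      then show ?thesis using lnb by (simp add: powr_mult mult_ac)
    qed
    finally show ?thesis by (simp add: mult_ac)
  qed
  have "summable (\<lambda>j. 2 * ln b powr (- b) * real j powr (- b))"
    using b by (intro summable_mult) (simp add: summable_real_powr_iff)
  then have "summable (\<lambda>j. prob (E j))"
    by (rule summable_comparison_test_ev[rotated])
      (use prob_E in \<open>auto simp: eventually_sequentially intro!: exI[of _ J]\<close>)
  then have "AE \<omega> in M. eventually (\<lambda>j. \<omega> \<in> space M - E j) sequentially"
    by (intro borel_cantelli_AE1) (auto simp: less_top[symmetric])
  then show ?thesis
  proof eventually_elim
    case (elim \<omega>)
    then obtain J' where J': "\<And>j. j \<ge> J' \<Longrightarrow> \<omega> \<in> space M - E j"
      by (auto simp: eventually_sequentially)
    have "eventually (\<lambda>n. V n \<ge> b ^ max J J') sequentially"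
      using V_top by (auto simp: filterlim_at_top)
    then show ?case
      using eventually_ge_at_top[of 1]
    proof eventually_elim
      case (elim n)
      obtain j where j: "j \<ge> max J J'" "b ^ j \<le> V n" "V n < b ^ Suc j"
        using ex_power_ivl[OF b elim(1)] .
      have "n \<in> {1..N j}" using elim j N(2)[of n j] by auto
      moreover have "\<omega> \<in> space M - E j" using J' j by auto
      ultimately have "\<bar>mart n \<omega>\<bar> < b * lil_norm (b ^ j)" by (force simp: E_def)
      also have "\<dots> \<le> b * lil_norm (V n)"
        using J[of j] j b by (intro mult_left_mono lil_norm_mono) auto
      finally show ?case by simp
    qed
  qed
qed

text \<open>The \<open>5 * d\<close> splits into \<open>3 * d\<close> lost in comparing the block
  increment with the norm at its end, and \<open>2 * d\<close> for the value at its start, which the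
  upper half bounds with factor 2. A one-sided bound on the increments suffices for the absolute
  value.\<close>

lemma mart_lower:
  assumes p01: "0 < p" "p < 1" and V_top: "filterlim (erw_var (2 * p - 1)) at_top sequentially"
    and incr_small: "(\<lambda>n. (erw_scale (2 * p - 1) n)\<^sup>2 * ln (ln (V n)) / V n) \<longlonglongrightarrow> 0"
    and drift: "AE \<omega> in M. (\<lambda>n. drift n \<omega>) \<longlonglongrightarrow> 0"
    and d: "0 < d" "d \<le> 1 / 2"
  shows "AE \<omega> in M. \<exists>\<^sub>F n in sequentially. (1 - 5 * d) * lil_norm (V n) \<le> \<bar>mart n \<omega>\<bar>"
proof -
  define b where "b = 2 / d\<^sup>2"
  have d2: "d\<^sup>2 \<le> 1 / 4" using power_mono[of d "1 / 2" 2] d by (simp add: power2_eq_square)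
  have b: "b \<ge> 8" using d d2 by (simp add: b_def field_simps)
  have "exp 1 \<le> (3 :: real)" by (rule exp_le)
  then have eb: "exp 1 \<le> b" using b by linarith
  then have lnb: "ln b \<ge> 1" using b by (simp add: ln_ge_iff)
  \<comment> \<open>The value of \<open>b\<close> makes the walk at the start of a block at most \<open>2 * d\<close> times the final norm.\<close>
  define t where "t j = (LEAST n. b ^ j \<le> V n)" for j
  have ex: "\<exists>n. b ^ j \<le> V n" for j
  proof -
    have "eventually (\<lambda>n. b ^ j \<le> V n) sequentially" using V_top by (auto simp: filterlim_at_top)
    then show ?thesis by (auto simp: eventually_sequentially)
  qed
  have t_ge: "b ^ j \<le> V (t j)" for j
    unfolding t_def by (rule LeastI_ex[OF ex])
  have t_least: "V n < b ^ j" if "n < t j" for n j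
    using not_less_Least[of n "\<lambda>n. b ^ j \<le> V n"] that by (simp add: t_def)
  have t1: "1 \<le> t j" for j
  proof (rule ccontr)
    assume "\<not> 1 \<le> t j"
    then have "V (t j) = 0" by (simp add: erw_var_def)
    then show False using t_ge[of j] b by (smt (verit) zero_less_power)
  qed
  have t_Suc: "t j \<le> t (Suc j)" for j
  proof -
    have "b ^ j \<le> b ^ Suc j" using b by (intro power_increasing) auto
    then have "b ^ j \<le> V (t (Suc j))" using t_ge[of "Suc j"] by linarith
    then show ?thesis unfolding t_def[of j] by (rule Least_le)
  qed
  have t_top: "filterlim t at_top sequentially"
    unfolding filterlim_at_top
  proof
    fix K
    have "eventually (\<lambda>j. V K < b ^ j) sequentially"
      using power_at_top[of b] b by (auto simp: filterlim_at_top_dense)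
    then show "eventually (\<lambda>j. K \<le> t j) sequentially"
    proof eventually_elim
      case (elim j)
      show ?case
      proof (rule ccontr)
        assume "\<not> K \<le> t j"
        then have "V (t j) \<le> V K" by (intro erw_var_mono) auto
        then show False using elim t_ge[of j] by simp
      qed
    qed
  qed
  have t_Suc_top: "filterlim (\<lambda>j. t (Suc j)) at_top sequentially"
    using t_top by (rule filterlim_compose) (rule filterlim_Suc)
  \<comment> \<open>Kolmogorov's condition with the maximum of \<open>erw_scale_le_max\<close> built
    in, so that its value at the end of a block governs the whole block.\<close>
  define sm where "sm n = max 1 ((scl n)\<^sup>2) * ln (ln (V n)) / V n" for n
  have "(\<lambda>n. ln (ln (V n)) / V n) \<longlonglongrightarrow> 0"
    by (rule filterlim_compose[OF _ V_top]) real_asymp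
  from tendsto_max[OF this incr_small]
  have "(\<lambda>n. max (ln (ln (V n)) / V n) ((scl n)\<^sup>2 * ln (ln (V n)) / V n)) \<longlonglongrightarrow> 0" by simp
  moreover have V_big: "eventually (\<lambda>n. V n \<ge> x) sequentially" for x
    using V_top by (auto simp: filterlim_at_top)
  have "eventually (\<lambda>n. max (ln (ln (V n)) / V n) ((scl n)\<^sup>2 * ln (ln (V n)) / V n) = sm n) sequentially"
    using V_big[of "exp 1"]
  proof eventually_elim
    case (elim n)
    have "0 \<le> ln (ln (V n)) / V n"
      using lnln_mono(1)[OF elim order_refl] elim exp_gt_zero[of "1::real"]
      by (intro divide_nonneg_nonneg) linarith+
    then have "max 1 ((scl n)\<^sup>2) * (ln (ln (V n)) / V n)
        = max (ln (ln (V n)) / V n) ((scl n)\<^sup>2 * (ln (ln (V n)) / V n))"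
      by (simp only: max_mult_distrib_right if_True mult_1)
    then show ?case
      unfolding sm_def times_divide_eq_right by (rule sym)
  qed
  ultimately have sm: "sm \<longlonglongrightarrow> 0" by (simp add: tendsto_cong)
  \<comment> \<open>No single jump of \<open>V\<close> exceeds half of its value, so the overshoot
    at \<open>t j\<close> is at most a factor 2.\<close>
  have "eventually (\<lambda>n. V n \<le> 2 * V (n - 1)) sequentially"
    using order_tendstoD(2)[OF sm half_gt_zero[OF zero_less_one]] V_big[of "exp (exp 1)"] eventually_ge_at_top[of 1]
  proof eventually_elim
    case (elim n)
    have V: "V n > 0" using elim(2) exp_gt_zero[of "exp 1 :: real"] by linarith
    then have "ln (V n) \<ge> exp 1" using elim(2) by (simp add: ln_ge_iff)
    moreover from this have "ln (V n) > 0" using exp_gt_zero[of "1::real"] by linarith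
    ultimately have "1 \<le> ln (ln (V n))" by (simp add: ln_ge_iff)
    then have "(scl n)\<^sup>2 * 1 \<le> max 1 ((scl n)\<^sup>2) * ln (ln (V n))"
      by (intro mult_mono) auto
    also have "\<dots> \<le> V n / 2" using elim(1) V by (simp add: sm_def field_simps)
    finally have "(scl n)\<^sup>2 \<le> V n / 2" by simp
    then show ?case using erw_var_Suc[of "2 * p - 1" "n - 1"] elim(3) by simp
  qed
  then have "eventually (\<lambda>j. V (t j) \<le> 2 * V (t j - 1)) sequentially"
    by (rule eventually_compose_filterlim[OF _ t_top])
  then have t_le: "eventually (\<lambda>j. V (t j) \<le> 2 * b ^ j) sequentially"
  proof eventually_elim
    case (elim j)
    then show ?case using t_least[of "t j - 1" j] t1[of j] by simp
  qed
  then have t_le': "eventually (\<lambda>j. V (t (Suc j)) \<le> 2 * b ^ Suc j) sequentially"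
    by (rule eventually_compose_filterlim[OF _ filterlim_Suc])
  define W where "W j = V (t (Suc j)) - V (t j)" for j
  have small_t: "eventually (\<lambda>j. V (t j) \<le> d\<^sup>2 * V (t (Suc j)) \<and> exp 1 \<le> V (t j)) sequentially"
    using t_le eventually_compose_filterlim[OF V_big[of "exp 1"] t_top]
  proof eventually_elim
    case (elim j)
    have "2 * b ^ j = d\<^sup>2 * b ^ Suc j" using d by (simp add: b_def)
    also have "\<dots> \<le> d\<^sup>2 * V (t (Suc j))" using t_ge[of "Suc j"] by (intro mult_left_mono) auto
    finally show ?case using elim by simp
  qed
  have lnln_ge: "eventually (\<lambda>j. ln (real j) \<le> ln (ln (V (t (Suc j)))) \<and> 0 \<le> ln (real j)) sequentially"
    using eventually_ge_at_top[of 1]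
  proof eventually_elim
    case (elim j)
    have "real j * 1 \<le> real (Suc j) * ln b" using lnb by (intro mult_mono) auto
    also have "\<dots> = ln (b ^ Suc j)" using b by (subst ln_realpow) auto
    also have "\<dots> \<le> ln (V (t (Suc j)))"
      using t_ge[of "Suc j"] b by (intro ln_mono) (auto simp del: power_Suc)
    finally have "real j \<le> ln (V (t (Suc j)))" by simp
    then show ?case using elim by simp
  qed
  \<comment> \<open>The overshoot factor 2 is absorbed by one more power of \<open>b\<close>, and
    shifting \<open>j\<close> or scaling it by \<open>ln b\<close> does not change its logarithm
    asymptotically.\<close>
  have lnln_le: "eventually (\<lambda>j. (1 - d) * ln (ln (V (t (Suc j)))) \<le> ln (real j)) sequentially"
  proof -
    define c where "c = ln b"
    have c: "c > 0" using lnb by (simp add: c_def)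
    have "(\<lambda>j. ln (real j) / ln (real (j + 2) * c)) \<longlonglongrightarrow> 1"
      using c by real_asymp
    then have "eventually (\<lambda>j. 1 - d < ln (real j) / ln (real (j + 2) * c)) sequentially"
      using d by (intro order_tendstoD) auto
    moreover have "eventually (\<lambda>j. ln (real (j + 2) * c) > 0) sequentially"
      using c by real_asymp
    ultimately show ?thesis using t_le' eventually_compose_filterlim[OF V_big[of "exp 1"] t_Suc_top]
    proof eventually_elim
      case (elim j)
      have "2 * b ^ Suc j \<le> b ^ (j + 2)" using b by simp
      then have "ln (ln (V (t (Suc j)))) \<le> ln (ln (b ^ (j + 2)))"
        using elim by (intro lnln_mono) auto
      also have "\<dots> = ln (real (j + 2) * c)" using b by (subst ln_realpow) (auto simp: c_def)
      finally have "(1 - d) * ln (ln (V (t (Suc j)))) \<le> (1 - d) * ln (real (j + 2) * c)"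
        using d by (intro mult_left_mono) auto
      also have "\<dots> \<le> ln (real j)" using elim by (simp add: field_simps)
      finally show ?case .
    qed
  qed
  \<comment> \<open>This \<open>L\<close> turns the lower bound of \<open>block_tail\<close> into the divergent series of \<open>1 / (2 * j)\<close>.\<close>
  define L where "L j = ln (real j) / (1 + d)\<^sup>2" for j
  define l where "l j = sqrt (2 * L j / W j)" for j
  have W: "eventually (\<lambda>j. W j \<ge> (1 - d\<^sup>2) * V (t (Suc j)) \<and> W j > 0) sequentially"
    using small_t
  proof eventually_elim
    case (elim j)
    have "V (t (Suc j)) > 0" using t_ge[of "Suc j"] b by (smt (verit) zero_less_power)
    then have "(1 - d\<^sup>2) * V (t (Suc j)) > 0" using d2 by simp
    then show ?case using elim by (auto simp: W_def algebra_simps)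
  qed
  \<comment> \<open>\<open>(l j * scl k)^2\<close> will be at most \<open>4 * sm\<close>: one 2 from
    \<open>l^2 = 2 * L / W\<close>, the other from \<open>W\<close> being at least half of
    \<open>V\<close>. The target is the bound \<open>d^2 / 16\<close> of
    \<open>block_tail\<close>.\<close>
  have d_pos: "0 < (d\<^sup>2 / 16)\<^sup>2 / 4" using d by simp
  have l: "eventually (\<lambda>j. 0 \<le> l j \<and> L j = (l j)\<^sup>2 * W j / 2
      \<and> (\<forall>k\<in>{t j<..t (Suc j)}. l j * scl k \<le> d\<^sup>2 / 16)) sequentially"
    using W lnln_ge eventually_compose_filterlim[OF order_tendstoD(2)[OF sm d_pos] t_Suc_top]
  proof eventually_elim
    case prems: (elim j)
    have "V (t (Suc j)) > 0" using t_ge[of "Suc j"] b by (smt (verit) zero_less_power)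
    let ?n = "t (Suc j)"
    have L: "0 \<le> L j" "L j \<le> ln (real j)"
      using prems(2) d by (auto simp: L_def divide_le_eq_1 mult_imp_div_pos_le mult_le_cancel_left1 one_le_power)
    have l2: "(l j)\<^sup>2 = 2 * L j / W j" using L prems(1) by (simp add: l_def)
    have "l j * scl k \<le> d\<^sup>2 / 16" if k: "k \<in> {t j<..?n}" for k
    proof (rule power2_le_imp_le)
      have "(l j * scl k)\<^sup>2 = 2 * L j / W j * (scl k)\<^sup>2" by (simp add: power_mult_distrib l2)
      also have "\<dots> \<le> (2 * ln (ln (V ?n)) / (V ?n / 2)) * max 1 ((scl ?n)\<^sup>2)"
      proof (intro mult_mono frac_le)
        have "(1 / 2) * V ?n \<le> (1 - d\<^sup>2) * V ?n"
          using d2 \<open>V ?n > 0\<close> by (intro mult_right_mono) auto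
        then show "V ?n / 2 \<le> W j" using prems(1) by linarith
        show "(scl k)\<^sup>2 \<le> max 1 ((scl ?n)\<^sup>2)"
          using k p01 by (intro erw_scale_le_max) auto
      qed (use L prems \<open>V ?n > 0\<close> in auto)
      also have "\<dots> = 4 * sm ?n" by (simp add: sm_def)
      also have "\<dots> \<le> (d\<^sup>2 / 16)\<^sup>2" using prems(3) d by simp
      finally show "(l j * scl k)\<^sup>2 \<le> (d\<^sup>2 / 16)\<^sup>2" .
    qed simp
    moreover have "0 \<le> l j" using L prems(1) by (simp add: l_def)
    ultimately show ?case using l2 prems(1) by (simp add: field_simps)
  qed
  have L_big: "eventually (\<lambda>j. exp (- L j * d\<^sup>2 / 2) \<le> 1 / 4) sequentially"
  proof -
    define a where "a = d\<^sup>2 / 2 / (1 + d)\<^sup>2"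
    have a: "a > 0" using d by (simp add: a_def)
    have "(\<lambda>j. exp (- (a * ln (real j)))) \<longlonglongrightarrow> 0" using a by real_asymp
    then have "eventually (\<lambda>j. exp (- (a * ln (real j))) < 1 / 4) sequentially"
      by (rule order_tendstoD) simp
    then show ?thesis by eventually_elim (simp add: L_def a_def field_simps)
  qed
  \<comment> \<open>The alternative of a positive \<open>bad_var\<close> is kept in the event so
    that its conditional probability is bounded below on every past; the convergence of the drift
    excludes it at the end.\<close>
  define B where "B j = {\<omega> \<in> space M. good_sum (d / 2) (t j) (t (Suc j)) \<omega> \<ge> (1 - d) * l j * W j
      \<or> bad_var (d / 2) (t j) (t (Suc j)) \<omega> > 0}" for j
  have B_hist: "B j \<in> sets (erw_history M \<eta> (t (Suc j)))" for j
  proof -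
    note [measurable] = block_measurable[OF t1[of j], of "d / 2" "t (Suc j)"]
    show ?thesis unfolding B_def space_history[of "t (Suc j)", symmetric] by measurable
  qed
  obtain J where J: "\<And>j. j \<ge> J \<Longrightarrow> exp (- L j * d\<^sup>2 / 2) \<le> 1 / 4"
    "\<And>j. j \<ge> J \<Longrightarrow> 0 \<le> l j \<and> L j = (l j)\<^sup>2 * W j / 2 \<and> (\<forall>k\<in>{t j<..t (Suc j)}. l j * scl k \<le> d\<^sup>2 / 16)"
    "\<And>j. j \<ge> J \<Longrightarrow> j \<ge> 1"
    using eventually_conj[OF L_big eventually_conj[OF l eventually_ge_at_top[of 1]]]
    unfolding eventually_sequentially by blast
  have often: "AE \<omega> in M. \<exists>\<^sub>F j in sequentially. \<omega> \<in> B j"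
  proof (rule conditional_borel_cantelli[where F = "\<lambda>j. sets (erw_history M \<eta> (t j))"
        and c = "\<lambda>j. 1 / 2 * inverse (real j)" and J = J])
    show "sets (erw_history M \<eta> (t j)) \<subseteq> sets M" for j using sets_history by blast
    show "space M \<in> sets (erw_history M \<eta> (t j))" for j
      using sets.top[of "erw_history M \<eta> (t j)"] by simp
    show "G - B j \<in> sets (erw_history M \<eta> (t (Suc j)))" if "G \<in> sets (erw_history M \<eta> (t j))" for j G
      using that sets_history_mono[OF t_Suc[of j]] B_hist[of j] by auto
    show "B j \<in> sets M" for j using B_hist sets_history by blast
    show "\<not> summable (\<lambda>j. 1 / 2 * inverse (real j))"
      using not_summable_harmonic[where 'a = real] by (subst summable_cmult_iff) auto
    show "1 / 2 * inverse (real j) * prob G \<le> prob (G \<inter> B j)"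
      if j: "J \<le> j" and G: "G \<in> sets (erw_history M \<eta> (t j))" for j G
    proof -
      have "prob G * (exp (- L j * (1 + d)\<^sup>2) / 2) \<le> prob (G \<inter> B j)"
        unfolding B_def
      proof (rule block_tail[OF p01 t1 t_Suc G])
        show "(d / 2)\<^sup>2 \<le> d\<^sup>2 / 4" by (simp add: power_divide)
        show "exp (- L j * d\<^sup>2 / 2) \<le> 1 / 4" by (rule J(1)[OF j])
      qed (use d J(2)[OF j] in \<open>auto simp: W_def\<close>)
      moreover have "exp (- L j * (1 + d)\<^sup>2) = inverse (real j)"
        using J(3)[OF j] d by (simp add: L_def exp_minus)
      ultimately show ?thesis by (simp add: mult_ac)
    qed
  qed auto
  have upper: "AE \<omega> in M. \<forall>\<^sub>F n in sequentially. \<bar>mart n \<omega>\<bar> \<le> 2 * lil_norm (V n)"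
    by (rule mart_upper[OF p01 V_top]) simp
  have det: "eventually (\<lambda>j. (1 - 5 * d) * lil_norm (V (t (Suc j)))
      \<le> (1 - d) * l j * W j - 2 * lil_norm (V (t j))) sequentially"
    using W small_t lnln_ge lnln_le l
  proof eventually_elim
    case (elim j)
    define v where "v = V (t (Suc j))"
    define v' where "v' = V (t j)"
    have v: "exp 1 \<le> v" "exp 1 \<le> v'" "v' \<le> v" "v > 0" "v' > 0"
      using elim(2) erw_var_mono[OF t_Suc[of j], of "2 * p - 1"] exp_gt_zero[of "1::real"]
      unfolding v_def v'_def by linarith+
    have lnv: "0 \<le> ln (ln v')" "ln (ln v') \<le> ln (ln v)" using v lnln_mono[of v' v] by auto
    have "lil_norm v' \<le> sqrt (2 * (d\<^sup>2 * v) * ln (ln v))"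
      unfolding lil_norm_def using lnv elim(2) v
      by (intro real_sqrt_le_mono mult_mono) (auto simp: v_def v'_def)
    also have "\<dots> = sqrt (d\<^sup>2 * (2 * v * ln (ln v)))" by (simp add: mult_ac)
    also have "\<dots> = d * lil_norm v" using d by (simp add: lil_norm_def real_sqrt_mult)
    finally have 1: "lil_norm v' \<le> d * lil_norm v" .
    have "(1 - d) * lil_norm v = sqrt ((1 - d)\<^sup>2 * (2 * v * ln (ln v)))"
      using d by (simp add: lil_norm_def real_sqrt_mult)
    also have "\<dots> \<le> sqrt (2 * W j * ln (real j))"
    proof (rule real_sqrt_le_mono)
      have "(1 - d)\<^sup>2 \<le> (1 - d\<^sup>2) * (1 - d)"
      proof -
        have "d * d \<le> d * 1" using d by (intro mult_left_mono) auto
        then have "1 - d \<le> 1 - d\<^sup>2" by (simp add: power2_eq_square)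
        then show ?thesis unfolding power2_eq_square[of "1 - d"] using d by (intro mult_right_mono) auto
      qed
      then have "(1 - d)\<^sup>2 * (2 * v * ln (ln v)) \<le> (1 - d\<^sup>2) * (1 - d) * (2 * v * ln (ln v))"
        using v lnv by (intro mult_right_mono) auto
      also have "\<dots> = 2 * ((1 - d\<^sup>2) * v) * ((1 - d) * ln (ln v))" by simp
      also have "\<dots> \<le> 2 * W j * ln (real j)"
      proof (intro mult_mono)
        show "(1 - d\<^sup>2) * v \<le> W j" "(1 - d) * ln (ln v) \<le> ln (real j)"
          using elim by (simp_all add: v_def)
        show "0 \<le> (1 - d\<^sup>2) * v" using d2 v by simp
        show "0 \<le> (1 - d) * ln (ln v)" using lnv d by simp
      qed (use elim in auto)
      finally show "(1 - d)\<^sup>2 * (2 * v * ln (ln v)) \<le> 2 * W j * ln (real j)" .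
    qed
    also have "sqrt (2 * W j * ln (real j)) = (1 + d) * (l j * W j)"
    proof -
      have "l j * W j \<ge> 0" using elim by simp
      have "(1 + d)\<^sup>2 * (2 * L j * W j) = 2 * W j * ln (real j)" using d by (simp add: L_def)
      moreover have "(l j * W j)\<^sup>2 = 2 * L j * W j" using elim by (simp add: power2_eq_square)
      ultimately have "2 * W j * ln (real j) = ((1 + d) * (l j * W j))\<^sup>2"
        by (simp only: power_mult_distrib[of "1 + d"])
      then show ?thesis using \<open>l j * W j \<ge> 0\<close> d by simp
    qed
    finally have 2: "(1 - d) * lil_norm v \<le> (1 + d) * (l j * W j)" .
    have n0: "lil_norm v \<ge> 0" using v lnv by (simp add: lil_norm_def)
    \<comment> \<open>Origin of the loss \<open>3 * d\<close>: one \<open>d\<close> from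
      \<open>block_tail\<close>, one from the norm comparison, one from the factor
      \<open>1 + d\<close> in \<open>L\<close>.\<close>
    have "(1 + d) * (1 - 3 * d) \<le> (1 - d) * (1 - d)" by (simp add: algebra_simps)
    then have "(1 + d) * (1 - 3 * d) * lil_norm v \<le> (1 - d) * (1 - d) * lil_norm v"
      using n0 by (intro mult_right_mono) auto
    also have "\<dots> \<le> (1 - d) * ((1 + d) * (l j * W j))"
      unfolding mult.assoc[of "1 - d" "1 - d"] using 2 d by (intro mult_left_mono) auto
    finally have "(1 + d) * ((1 - 3 * d) * lil_norm v) \<le> (1 + d) * ((1 - d) * l j * W j)"
      by (simp add: mult_ac)
    then have "(1 - 3 * d) * lil_norm v \<le> (1 - d) * l j * W j"
      using d by (subst (asm) mult_le_cancel_left_pos) auto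
    then show ?case using 1 unfolding v_def v'_def by (simp add: algebra_simps)
  qed
  show ?thesis
    using often upper drift
  proof eventually_elim
    case (elim \<omega>)
    have "eventually (\<lambda>n. \<bar>drift n \<omega>\<bar> < d / 2) sequentially"
      using tendstoD[OF elim(3), of "d / 2"] d by (simp add: dist_real_def)
    then obtain K where K: "\<And>n. n \<ge> K \<Longrightarrow> \<bar>drift n \<omega>\<bar> < d / 2"
      by (auto simp: eventually_sequentially)
    have "eventually (\<lambda>j. bad_var (d / 2) (t j) (t (Suc j)) \<omega> \<le> 0) sequentially"
      using t_top[unfolded filterlim_at_top, rule_format, of K]
    proof eventually_elim
      case (elim j)
      have "bad_var (d / 2) (t j) (t (Suc j)) \<omega> = 0"
        unfolding bad_var_def by (intro sum.neutral) (use K elim in \<open>force simp: less_imp_le\<close>)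
      then show ?case by simp
    qed
    moreover note det eventually_compose_filterlim[OF elim(2) t_top]
    ultimately have "eventually (\<lambda>j. \<omega> \<in> B j \<longrightarrow>
        (1 - 5 * d) * lil_norm (V (t (Suc j))) \<le> \<bar>mart (t (Suc j)) \<omega>\<bar>) sequentially"
    proof eventually_elim
      case (elim j)
      then show ?case
        using mart_block_eq[OF t1 t_Suc elim(1) p01(1)] by (auto simp: B_def)
    qed
    then have "\<exists>\<^sub>F j in sequentially. (1 - 5 * d) * lil_norm (V (t (Suc j))) \<le> \<bar>mart (t (Suc j)) \<omega>\<bar>"
      by (rule frequently_rev_mp[OF elim(1)])
    then show ?case
      unfolding frequently_def
      using eventually_compose_filterlim[OF _ t_Suc_top] by blast
  qed
qed

section \<open>The limsup of the martingale and its transfer to the position\<close>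

lemma mart_lil:
  assumes p01: "0 < p" "p < 1" and V_top: "filterlim (erw_var (2 * p - 1)) at_top sequentially"
    and incr_small: "(\<lambda>n. (erw_scale (2 * p - 1) n)\<^sup>2 * ln (ln (V n)) / V n) \<longlonglongrightarrow> 0"
    and drift: "AE \<omega> in M. (\<lambda>n. drift n \<omega>) \<longlonglongrightarrow> 0"
  shows "AE \<omega> in M. limsup (\<lambda>n. ereal (\<bar>mart n \<omega>\<bar> / lil_norm (V n))) = 1"
proof -
  have pos: "eventually (\<lambda>n. lil_norm (V n) > 0) sequentially"
    using filterlim_compose[OF lil_norm_at_top V_top] by (auto simp: filterlim_at_top_dense)
  have "AE \<omega> in M. limsup (\<lambda>n. ereal (\<bar>mart n \<omega>\<bar> / lil_norm (V n))) \<le> ereal (1 + inverse (real (Suc i)))" for i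
    using mart_upper[OF p01 V_top, of "1 + inverse (real (Suc i))", simplified]
  proof eventually_elim
    case (elim \<omega>)
    have "eventually (\<lambda>n. ereal (\<bar>mart n \<omega>\<bar> / lil_norm (V n)) \<le> ereal (1 + inverse (real (Suc i)))) sequentially"
      using elim pos by eventually_elim (simp add: pos_divide_le_eq)
    then show ?case by (rule Limsup_bounded)
  qed
  then have "AE \<omega> in M. \<forall>i. limsup (\<lambda>n. ereal (\<bar>mart n \<omega>\<bar> / lil_norm (V n))) \<le> ereal (1 + inverse (real (Suc i)))"
    by (subst AE_all_countable) auto
  \<comment> \<open>The shift by 2 keeps \<open>d\<close> at most \<open>1 / 2\<close>; for small
    \<open>i\<close> the bound is negative and harmless.\<close>
  moreover have "AE \<omega> in M. ereal (1 - 5 * (1 / real (i + 2))) \<le> limsup (\<lambda>n. ereal (\<bar>mart n \<omega>\<bar> / lil_norm (V n)))" for i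
    using mart_lower[OF p01 V_top incr_small drift, of "1 / real (i + 2)", simplified]
  proof eventually_elim
    case (elim \<omega>)
    show ?case
    proof (rule ccontr)
      assume "\<not> ?thesis"
      then have "eventually (\<lambda>n. ereal (\<bar>mart n \<omega>\<bar> / lil_norm (V n)) < ereal (1 - 5 * (1 / real (i + 2)))) sequentially"
        by (intro Limsup_lessD) auto
      with pos have "eventually (\<lambda>n. \<not> (1 - 5 * (1 / real (i + 2))) * lil_norm (V n) \<le> \<bar>mart n \<omega>\<bar>) sequentially"
        by eventually_elim (simp add: divide_less_eq)
      with elim show False by (simp add: frequently_def)
    qed
  qed
  then have "AE \<omega> in M. \<forall>i. ereal (1 - 5 * (1 / real (i + 2))) \<le> limsup (\<lambda>n. ereal (\<bar>mart n \<omega>\<bar> / lil_norm (V n)))"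
    by (subst AE_all_countable) auto
  ultimately show ?thesis
  proof eventually_elim
    case (elim \<omega>)
    have "(\<lambda>i. ereal (1 + inverse (real (Suc i)))) \<longlonglongrightarrow> ereal 1"
      by (intro tendsto_ereal) real_asymp
    then have "limsup (\<lambda>n. ereal (\<bar>mart n \<omega>\<bar> / lil_norm (V n))) \<le> ereal 1"
      by (rule LIMSEQ_le_const) (use elim(1) in auto)
    moreover have "(\<lambda>i. ereal (1 - 5 * (1 / real (i + 2)))) \<longlonglongrightarrow> ereal 1"
      by (intro tendsto_ereal) real_asymp
    then have "ereal 1 \<le> limsup (\<lambda>n. ereal (\<bar>mart n \<omega>\<bar> / lil_norm (V n)))"
      by (rule LIMSEQ_le_const2) (use elim(2) in auto)
    ultimately show ?case by (simp add: one_ereal_def)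
  qed
qed

text \<open>Shared by both regimes: \<open>g\<close> is the normalisation in the claim,
  \<open>h\<close> an explicit substitute for \<open>ln (ln (V n))\<close>, and the constant arises
  only as the limit \<open>K\<close> of the two norms. The conditions on \<open>h\<close> and
  \<open>g\<close> yield Kolmogorov's condition and the decay of the drift.\<close>

lemma position_lil:
  fixes g h :: "nat \<Rightarrow> real"
  assumes p01: "0 < p" "p < 1" and V_top: "filterlim (erw_var (2 * p - 1)) at_top sequentially"
    and K: "K > 0" "(\<lambda>n. lil_norm (V n) / (scl n * g n)) \<longlonglongrightarrow> K"
    and h: "(\<lambda>n. ln (ln (V n)) / h n) \<longlonglongrightarrow> 1" "(\<lambda>n. h n / g n) \<longlonglongrightarrow> 0"
    and g: "(\<lambda>n. g n / real n) \<longlonglongrightarrow> 0"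
  shows "AE \<omega> in M. limsup (\<lambda>n. ereal (\<bar>real_of_int (erw_position \<eta> n \<omega>)\<bar> / g n)) = ereal K"
proof -
  have norm_top: "filterlim (\<lambda>n. lil_norm (V n)) at_top sequentially"
    using filterlim_compose[OF lil_norm_at_top V_top] .
  have pos: "eventually (\<lambda>n. lil_norm (V n) > 0) sequentially"
    using norm_top by (auto simp: filterlim_at_top_dense)
  have scale: "scl n > 0" for n using erw_scale_pos[of "2 * p - 1" n] p01 by simp
  have nz: "eventually (\<lambda>n. h n \<noteq> 0 \<and> g n > 0) sequentially"
    using order_tendstoD(1)[OF K(2) K(1)] order_tendstoD(1)[OF h(1) zero_less_one] pos
  proof eventually_elim
    case (elim n)
    then show ?case using scale[of n] by (auto simp: zero_less_divide_iff zero_less_mult_iff)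
  qed
  \<comment> \<open>Because the square of \<open>lil_norm (V n)\<close> is
    \<open>2 * V n * ln (ln (V n))\<close>, Kolmogorov's quantity is
    \<open>2 * (ln (ln (V n)) * scl n / lil_norm (V n))^2\<close>; it is expanded into factors with
    known limits.\<close>
  have "(\<lambda>n. 2 * ((ln (ln (V n)) / h n) * (h n / g n) / (lil_norm (V n) / (scl n * g n)))\<^sup>2)
      \<longlonglongrightarrow> 2 * (1 * 0 / K)\<^sup>2"
    using K(1) by (intro tendsto_intros K(2) h) auto
  moreover have "eventually (\<lambda>n. 2 * ((ln (ln (V n)) / h n) * (h n / g n) / (lil_norm (V n) / (scl n * g n)))\<^sup>2
      = (scl n)\<^sup>2 * ln (ln (V n)) / V n) sequentially"
    using nz pos V_top[unfolded filterlim_at_top, rule_format, of "1"]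
  proof eventually_elim
    case (elim n)
    have "2 * V n * ln (ln (V n)) > 0" using elim(2) by (simp add: lil_norm_def)
    then have sq: "(lil_norm (V n))\<^sup>2 = 2 * V n * ln (ln (V n))" and "ln (ln (V n)) \<noteq> 0"
      by (auto simp: lil_norm_def)
    have "(ln (ln (V n)) / h n) * (h n / g n) / (lil_norm (V n) / (scl n * g n))
      = ln (ln (V n)) * scl n / lil_norm (V n)" using elim by simp
    then show ?case
      using \<open>ln (ln (V n)) \<noteq> 0\<close> elim by (simp add: power_divide power_mult_distrib sq) (simp add: power2_eq_square)
  qed
  ultimately have "(\<lambda>n. (scl n)\<^sup>2 * ln (ln (V n)) / V n) \<longlonglongrightarrow> 2 * (1 * 0 / K)\<^sup>2"
    by (rule Lim_transform_eventually)
  then have incr_small: "(\<lambda>n. (scl n)\<^sup>2 * ln (ln (V n)) / V n) \<longlonglongrightarrow> 0"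
    by simp
  have step1: "\<bar>real_of_int (\<eta> 1 \<omega>)\<bar> = 1" if "\<omega> \<in> space M" for \<omega>
    using step_values[OF _ that, of 1] by auto
  have "AE \<omega> in M. (\<lambda>n. drift n \<omega>) \<longlonglongrightarrow> 0"
    using mart_upper[OF p01 V_top, of 2, simplified] AE_space
  proof eventually_elim
    case (elim \<omega>)
    have "(\<lambda>n. 3 * (lil_norm (V n) / (scl n * g n) * (g n / real n))) \<longlonglongrightarrow> 3 * (K * 0)"
      by (intro tendsto_intros K(2) g)
    then have lim: "(\<lambda>n. 3 * (lil_norm (V n) / (scl n * g n) * (g n / real n))) \<longlonglongrightarrow> 0" by simp
    have "eventually (\<lambda>n. norm (drift n \<omega>) \<le> 3 * (lil_norm (V n) / (scl n * g n) * (g n / real n))) sequentially"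
      using elim(1) nz norm_top[unfolded filterlim_at_top, rule_format, of 1] eventually_ge_at_top[of 1]
    proof eventually_elim
      case prems: (elim n)
      define X where "X = real_of_int (erw_position \<eta> n \<omega>)"
      have "scl n * \<bar>X\<bar> = \<bar>scl n * X\<bar>"
        using scale[of n] by (simp add: abs_mult)
      also have "scl n * X = real_of_int (\<eta> 1 \<omega>) + mart n \<omega>"
        using scale_position_eq[OF p01(1) prems(4), of \<omega>] by (simp add: X_def)
      \<comment> \<open>Two from \<open>mart_upper\<close>, one for the first step, as the norm has
        passed \<open>1\<close>.\<close>
      also have "\<bar>\<dots>\<bar> \<le> 3 * lil_norm (V n)"
        using step1[OF elim(2)] prems(1,3) by linarith
      finally have X: "\<bar>X\<bar> \<le> 3 * lil_norm (V n) / scl n"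
        using scale[of n] by (simp add: field_simps)
      have "norm (drift n \<omega>) = \<bar>2 * p - 1\<bar> * \<bar>X\<bar> / real n"
        by (simp add: drift_def X_def abs_mult)
      also have "\<dots> \<le> 1 * (3 * lil_norm (V n) / scl n) / real n"
        using p01 X by (intro divide_right_mono mult_mono) auto
      also have "\<dots> = 3 * (lil_norm (V n) / (scl n * g n) * (g n / real n))"
        using prems(2) by simp
      finally show ?case .
    qed
    then show ?case using lim by (rule Lim_null_comparison)
  qed
  from mart_lil[OF p01 V_top incr_small this] AE_space
  show ?thesis
  proof eventually_elim
    case (elim \<omega>)
    \<comment> \<open>The effect of the first step on the normalised martingale; it is at most
      \<open>1 / lil_norm (V n)\<close>.\<close>
    define u where "u n = (\<bar>real_of_int (\<eta> 1 \<omega>) + mart n \<omega>\<bar> - \<bar>mart n \<omega>\<bar>) / lil_norm (V n)" for n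
    have "(\<lambda>n. 1 / lil_norm (V n)) \<longlonglongrightarrow> 0"
      using norm_top by (rule tendsto_divide_0[OF tendsto_const, OF filterlim_at_top_imp_at_infinity])
    moreover have "eventually (\<lambda>n. norm (u n) \<le> 1 / lil_norm (V n)) sequentially"
      using pos
    proof eventually_elim
      case (elim n)
      have "\<bar>\<bar>real_of_int (\<eta> 1 \<omega>) + mart n \<omega>\<bar> - \<bar>mart n \<omega>\<bar>\<bar> \<le> 1"
        using step1[OF \<open>\<omega> \<in> space M\<close>] by linarith
      then show ?case using elim by (simp add: u_def abs_divide divide_right_mono)
    qed
    ultimately have "u \<longlonglongrightarrow> 0" by (rule Lim_null_comparison[rotated])
    then have "limsup (\<lambda>n. ereal (u n) + ereal (\<bar>mart n \<omega>\<bar> / lil_norm (V n))) = ereal 0 + 1"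
      using elim(1) by (subst ereal_limsup_lim_add[of _ "ereal 0"]) auto
    moreover have "limsup (\<lambda>n. ereal (lil_norm (V n) / (scl n * g n))
        * (ereal (u n) + ereal (\<bar>mart n \<omega>\<bar> / lil_norm (V n))))
      = ereal K * limsup (\<lambda>n. ereal (u n) + ereal (\<bar>mart n \<omega>\<bar> / lil_norm (V n)))"
      by (rule ereal_limsup_lim_mult) (use K in auto)
    moreover have "limsup (\<lambda>n. ereal (lil_norm (V n) / (scl n * g n))
        * (ereal (u n) + ereal (\<bar>mart n \<omega>\<bar> / lil_norm (V n))))
      = limsup (\<lambda>n. ereal (\<bar>real_of_int (erw_position \<eta> n \<omega>)\<bar> / g n))"
    proof (rule Limsup_eq)
      show "eventually (\<lambda>n. ereal (lil_norm (V n) / (scl n * g n))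
        * (ereal (u n) + ereal (\<bar>mart n \<omega>\<bar> / lil_norm (V n)))
        = ereal (\<bar>real_of_int (erw_position \<eta> n \<omega>)\<bar> / g n)) sequentially"
        using nz pos eventually_ge_at_top[of 1]
      proof eventually_elim
        case (elim n)
        have "u n + \<bar>mart n \<omega>\<bar> / lil_norm (V n) = \<bar>real_of_int (\<eta> 1 \<omega>) + mart n \<omega>\<bar> / lil_norm (V n)"
          by (simp add: u_def diff_divide_distrib)
        also have "\<dots> = scl n * \<bar>real_of_int (erw_position \<eta> n \<omega>)\<bar> / lil_norm (V n)"
          using scale_position_eq[OF p01(1) elim(3), of \<omega>, symmetric] scale[of n] by (simp add: abs_mult)
        finally show ?case using elim scale[of n] by simp
      qed
    qed
    ultimately show ?case by simp
  qed
qed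

section \<open>Growth rates and constants in the two regimes\<close>

lemma position_lil_diffusive:
  assumes p01: "0 < p" "p < 3 / 4"
  shows "AE \<omega> in M. limsup (\<lambda>n. ereal (\<bar>real_of_int (erw_position \<eta> n \<omega>)\<bar> / sqrt (real n * ln (ln (real n)))))
    = ereal (sqrt (2 / (3 - 4 * p)))"
proof -
  define s where "s = 2 * p - 1"
  have s: "s > -1" "s < 1 / 2" using p01 by (auto simp: s_def)
  define C where "C = (Gamma (1 + s))\<^sup>2"
  have C: "C > 0" using Gamma_sq_pos[OF s(1)] by (simp add: C_def)
  have V: "(\<lambda>n. erw_var s n / real n powr (1 - 2 * s)) \<longlonglongrightarrow> C / (1 - 2 * s)"
    using erw_var_asymp_diffusive[OF s] by (simp add: C_def)
  have c: "C / (1 - 2 * s) > 0" using C s by simp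
  have powr_top: "filterlim (\<lambda>n. real n powr (1 - 2 * s)) at_top sequentially"
    using s by real_asymp
  have "filterlim (\<lambda>n. erw_var s n / real n powr (1 - 2 * s) * real n powr (1 - 2 * s)) at_top sequentially"
    by (rule filterlim_tendsto_pos_mult_at_top[OF V c powr_top])
  moreover have "eventually (\<lambda>n. erw_var s n / real n powr (1 - 2 * s) * real n powr (1 - 2 * s) = erw_var s n) sequentially"
    using eventually_gt_at_top[of 0] by eventually_elim simp
  ultimately have V_top: "filterlim (erw_var s) at_top sequentially"
    by (simp cong: filterlim_cong)
  have "(\<lambda>n. ln (erw_var s n) / ln (real n powr (1 - 2 * s))) \<longlonglongrightarrow> 1"
    by (rule tendsto_ln_quotient[OF V c powr_top])
  then have "(\<lambda>n. (1 - 2 * s) * (ln (erw_var s n) / ((1 - 2 * s) * ln (real n)))) \<longlonglongrightarrow> (1 - 2 * s) * 1"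
    by (intro tendsto_mult tendsto_const) (simp add: ln_powr)
  then have lnV: "(\<lambda>n. ln (erw_var s n) / ln (real n)) \<longlonglongrightarrow> 1 - 2 * s"
    using s by simp
  \<comment> \<open>The limit \<open>1 - 2 * s\<close> of the single logarithms is a constant factor
    and disappears in the second logarithm.\<close>
  have lnlnV: "(\<lambda>n. ln (ln (erw_var s n)) / ln (ln (real n))) \<longlonglongrightarrow> 1"
    by (rule tendsto_ln_quotient[OF lnV]) (use s in simp, real_asymp)
  \<comment> \<open>The Gamma factor \<open>C\<close> occurs in both the variance and the squared
    scale and cancels, leaving \<open>2 / (1 - 2 * s)\<close>.\<close>
  have "(\<lambda>n. sqrt (2 * ((erw_var s n / real n powr (1 - 2 * s)) / ((erw_scale s n)\<^sup>2 * real n powr (2 * s)))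
      * (ln (ln (erw_var s n)) / ln (ln (real n))))) \<longlonglongrightarrow> sqrt (2 * ((C / (1 - 2 * s)) / C) * 1)"
    using C erw_scale_sq_asymp[OF s(1)] by (intro tendsto_intros V lnlnV) (auto simp: C_def)
  moreover have "eventually (\<lambda>n. sqrt (2 * ((erw_var s n / real n powr (1 - 2 * s)) / ((erw_scale s n)\<^sup>2 * real n powr (2 * s)))
      * (ln (ln (erw_var s n)) / ln (ln (real n))))
      = lil_norm (erw_var s n) / (erw_scale s n * sqrt (real n * ln (ln (real n))))) sequentially"
    using eventually_gt_at_top[of 0]
  proof eventually_elim
    case (elim n)
    have "real n powr (1 - 2 * s) * real n powr (2 * s) = real n"
      using elim by (simp flip: powr_add)
    then have eq: "2 * ((erw_var s n / real n powr (1 - 2 * s)) / ((erw_scale s n)\<^sup>2 * real n powr (2 * s)))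
      * (ln (ln (erw_var s n)) / ln (ln (real n)))
      = (2 * erw_var s n * ln (ln (erw_var s n))) / ((erw_scale s n)\<^sup>2 * (real n * ln (ln (real n))))"
      by (simp add: mult_ac)
    show ?case
      unfolding eq using erw_scale_pos[OF s(1), of n] by (simp add: lil_norm_def real_sqrt_divide real_sqrt_mult)
  qed
  ultimately have K: "(\<lambda>n. lil_norm (erw_var s n) / (erw_scale s n * sqrt (real n * ln (ln (real n)))))
      \<longlonglongrightarrow> sqrt (2 / (3 - 4 * p))"
    using C by (simp add: tendsto_cong s_def)
  show ?thesis
  proof (rule position_lil)
    show "(\<lambda>n. ln (ln (real n)) / sqrt (real n * ln (ln (real n)))) \<longlonglongrightarrow> 0" by real_asymp
    show "(\<lambda>n. sqrt (real n * ln (ln (real n))) / real n) \<longlonglongrightarrow> 0" by real_asymp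
  qed (use p01 V_top K lnlnV in \<open>auto simp: s_def\<close>)
qed

lemma position_lil_critical:
  assumes p: "p = 3 / 4"
  shows "AE \<omega> in M. limsup (\<lambda>n. ereal (\<bar>real_of_int (erw_position \<eta> n \<omega>)\<bar> /
      sqrt (real n * ln (real n) * ln (ln (ln (real n)))))) = ereal (sqrt 2)"
proof -
  define s :: real where "s = 1 / 2"
  have s: "s > -1" "s = 1 / 2" by (auto simp: s_def)
  have ps: "2 * p - 1 = s" using p by (simp add: s_def)
  define C where "C = (Gamma (1 + s))\<^sup>2"
  have C: "C > 0" using Gamma_sq_pos[OF s(1)] by (simp add: C_def)
  have V: "(\<lambda>n. erw_var s n / ln (real n)) \<longlonglongrightarrow> C"
    using erw_var_asymp_critical[OF s] by (simp add: C_def)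
  have ln_top: "filterlim (\<lambda>n. ln (real n)) at_top sequentially" by real_asymp
  have "filterlim (\<lambda>n. erw_var s n / ln (real n) * ln (real n)) at_top sequentially"
    by (rule filterlim_tendsto_pos_mult_at_top[OF V C ln_top])
  moreover have "eventually (\<lambda>n. erw_var s n / ln (real n) * ln (real n) = erw_var s n) sequentially"
    using eventually_gt_at_top[of 1] by eventually_elim simp
  ultimately have V_top: "filterlim (erw_var s) at_top sequentially"
    by (simp cong: filterlim_cong)
  have lnV: "(\<lambda>n. ln (erw_var s n) / ln (ln (real n))) \<longlonglongrightarrow> 1"
    by (rule tendsto_ln_quotient[OF V C ln_top])
  have lnlnV: "(\<lambda>n. ln (ln (erw_var s n)) / ln (ln (ln (real n)))) \<longlonglongrightarrow> 1"
    by (rule tendsto_ln_quotient[OF lnV]) (simp, real_asymp)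
  \<comment> \<open>Here the power \<open>n powr (2 * s)\<close> is \<open>n\<close> itself and
    \<open>V\<close> grows like \<open>C * ln n\<close>, hence the extra logarithm in the norm;
    after cancelling \<open>C\<close> only the 2 of the classical law is left.\<close>
  have "(\<lambda>n. sqrt (2 * ((erw_var s n / ln (real n)) / ((erw_scale s n)\<^sup>2 * real n powr (2 * s)))
      * (ln (ln (erw_var s n)) / ln (ln (ln (real n)))))) \<longlonglongrightarrow> sqrt (2 * (C / C) * 1)"
    using C erw_scale_sq_asymp[OF s(1)] by (intro tendsto_intros V lnlnV) (auto simp: C_def)
  moreover have "sqrt (2 * ((erw_var s n / ln (real n)) / ((erw_scale s n)\<^sup>2 * real n powr (2 * s)))
      * (ln (ln (erw_var s n)) / ln (ln (ln (real n)))))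
      = lil_norm (erw_var s n) / (erw_scale s n * sqrt (real n * ln (real n) * ln (ln (ln (real n)))))" for n
  proof -
    have eq: "2 * ((erw_var s n / ln (real n)) / ((erw_scale s n)\<^sup>2 * real n powr (2 * s)))
      * (ln (ln (erw_var s n)) / ln (ln (ln (real n))))
      = (2 * erw_var s n * ln (ln (erw_var s n))) / ((erw_scale s n)\<^sup>2 * (real n * ln (real n) * ln (ln (ln (real n)))))"
      by (simp add: s(2) mult_ac)
    show ?thesis
      unfolding eq using erw_scale_pos[OF s(1), of n] by (simp add: lil_norm_def real_sqrt_divide real_sqrt_mult)
  qed
  ultimately have K: "(\<lambda>n. lil_norm (erw_var s n) / (erw_scale s n * sqrt (real n * ln (real n) * ln (ln (ln (real n))))))
      \<longlonglongrightarrow> sqrt 2"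
    using C by simp
  show ?thesis
  proof (rule position_lil)
    show "(\<lambda>n. ln (ln (ln (real n))) / sqrt (real n * ln (real n) * ln (ln (ln (real n))))) \<longlonglongrightarrow> 0"
      by real_asymp
    show "(\<lambda>n. sqrt (real n * ln (real n) * ln (ln (ln (real n)))) / real n) \<longlonglongrightarrow> 0"
      by real_asymp
  qed (use p V_top K lnlnV in \<open>auto simp: ps\<close>)
qed

end

theorem corollary1:
  fixes M :: "'a measure" and p q :: real and \<eta> :: "nat \<Rightarrow> 'a \<Rightarrow> int"
  assumes "0 < p" and "p < 1" and "p \<le> 3 / 4"
    and "0 \<le> q" and "q \<le> 1"
    and "elephant_random_walk M p q \<eta>"
  shows "(p < 3 / 4 \<longrightarrow>
      (AE \<omega> in M.
        limsup (\<lambda>n. ereal (\<bar>real_of_int (erw_position \<eta> n \<omega>)\<bar> /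
          sqrt (real n * ln (ln (real n))))) =
        ereal (sqrt (2 / (3 - 4 * p))))) \<and>
    (p = 3 / 4 \<longrightarrow>
      (AE \<omega> in M.
        limsup (\<lambda>n. ereal (\<bar>real_of_int (erw_position \<eta> n \<omega>)\<bar> /
          sqrt (real n * ln (real n) * ln (ln (ln (real n)))))) =
        ereal (sqrt 2)))"
proof -
  interpret elephant_random_walk M p q \<eta> by fact
  show ?thesis
    using position_lil_diffusive position_lil_critical assms(1) by blast
qed

end
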